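(* Let $m,n\ge 1$ be integers, $d=m+n$, $\Theta\in\mathbb{R}^{n\times m}$, and let $\boldsymbol\sigma=(\sigma_1,\dots,\sigma_m)$, $\boldsymbol\rho=(\rho_1,\dots,\rho_n)$ be weights with $\sigma_1\ge\dots\ge\sigma_m>0$, $\rho_1\ge\dots\ge\rho_n>0$, $\sum_j\sigma_j=\sum_i\rho_i=1$. For $k=1,\dots,d$ set $\Omega_k=\Omega^{(k)}_{\boldsymbol\sigma,\boldsymbol\rho}(\Theta)$ and ${}^t\Omega_k=\Omega^{(k)}_{\boldsymbol\rho,\boldsymbol\sigma}({}^t\Theta)$ (defined in the context). Then \[ \Omega_1\ge\dots\ge\Omega_k\ge\dots\ge\Omega_{d-1}\ge\frac{(\sigma_m^{-1}-1)+\rho_n^{-1}\,{}^t\Omega_1}{\sigma_m^{-1}+(\rho_n^{-1}-1)\,{}^t\Omega_1}. \]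
   Context: Exterior powers: for $1\le k\le d$, elements of $\bigwedge^k(\mathbb{R}^d)$ are written $\mathbf Z=(Z_{i_1,\dots,i_k})$, the coordinates with respect to the basis $\mathbf e_{i_1}\wedge\dots\wedge\mathbf e_{i_k}$, $i_1<\dots<i_k$, of the standard basis. For a lattice $\Lambda\subset\mathbb{R}^d$, $\bigwedge^k(\Lambda)$ is the lattice generated by all $\mathbf z_1\wedge\dots\wedge\mathbf z_k$, $\mathbf z_i\in\Lambda$. For a box $\mathcal P=\{\mathbf z\in\mathbb{R}^d: |z_i|\le c_i,\ i=1,\dots,d\}$ set $\mathcal P^{[k]}=\{\mathbf Z\in\bigwedge^k(\mathbb{R}^d): |Z_{i_1,\dots,i_k}|\le\prod_{j=1}^k c_{i_j}\ \text{for all } i_1<\dots<i_k\}$. Let $\Lambda(\Theta)=\begin{pmatrix}I_m&0\\-\Theta&I_n\end{pmatrix}\mathbb{Z}^d$ and, for $s,\gamma\in\mathbb{R}$, $\mathcal P(s,\gamma)=\{\mathbf z\in\mathbb{R}^d: |z_j|\le e^{s\sigma_j}\ (j=1,\dots,m),\ |z_{d+1-i}|\le e^{-s\rho_i\gamma}\ (i=1,\dots,n)\}$. The $k$-th weighted Diophantine exponent of the second type $\Omega^{(k)}_{\boldsymbol\sigma,\boldsymbol\rho}(\Theta)$ is the supremum of real $\gamma$ such that $\mathcal P^{[k]}(s,\gamma)$ contains a nonzero element of $\bigwedge^k(\Lambda(\Theta))$ for arbitrarily large $s$. The exponent $\Omega^{(k)}_{\boldsymbol\rho,\boldsymbol\sigma}({}^t\Theta)$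 is defined in the same way with $(\Theta,\boldsymbol\sigma,\boldsymbol\rho,m,n)$ replaced by $({}^t\Theta,\boldsymbol\rho,\boldsymbol\sigma,n,m)$, i.e. using the lattice $\begin{pmatrix}I_n&0\\-{}^t\Theta&I_m\end{pmatrix}\mathbb{Z}^d$ and the boxes $\{\mathbf z: |z_i|\le e^{s\rho_i}\ (i=1,\dots,n),\ |z_{d+1-j}|\le e^{-s\sigma_j\gamma}\ (j=1,\dots,m)\}$.
   Formalization: The boxes attach ρ_i to z_{m+i} (and σ_j to z_{n+j} for the transpose) instead of z_{d+1-i} (z_{d+1-j}), since the literal pairing makes the claim false for unequal weights; for ᵗΩ_1 = ∞ the fraction is read as its limit. *)

theory Defs
  imports
    "HOL-Library.Extended_Real"
    "HOL-Library.Function_Algebras"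
    "HOL-Computational_Algebra.Group_Closure"
    "Jordan_Normal_Form.Determinant"
    "Jordan_Normal_Form.DL_Submatrix"
begin

text \<open>
  All coordinates are numbered from 0. An element of the \<open>k\<close>-th exterior power of the
  \<open>d\<close>-dimensional real space is given by its coordinates with respect to the standard basis;
  the coordinate with indices \<open>i\<^sub>1 < \<dots> < i\<^sub>k\<close> is indexed by the set \<open>{i\<^sub>1, \<dots>, i\<^sub>k}\<close>, and the
  value at any other set of naturals is 0.
\<close>

definition exterior_power :: "nat \<Rightarrow> nat \<Rightarrow> (nat set \<Rightarrow> real) set" where
  "exterior_power d k = {Z. \<forall>I. \<not> (I \<subseteq> {..<d} \<and> card I = k) \<longrightarrow> Z I = 0}"

text \<open>
  The coordinates of \<open>z\<^sub>1 \<and> \<dots> \<and> z\<^sub>k\<close> are the maximal minors of the matrix with columns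
  \<open>z\<^sub>1, \<dots>, z\<^sub>k\<close>.
\<close>

definition wedge :: "nat \<Rightarrow> real vec list \<Rightarrow> nat set \<Rightarrow> real" where
  "wedge d zs I =
    (if I \<subseteq> {..<d} \<and> card I = length zs
     then det (submatrix (mat_of_cols d zs) I UNIV) else 0)"

definition exterior_lattice :: "nat \<Rightarrow> nat \<Rightarrow> real vec set \<Rightarrow> (nat set \<Rightarrow> real) set" where
  "exterior_lattice d k L = group_closure {wedge d zs | zs. length zs = k \<and> set zs \<subseteq> L}"

text \<open>
  \<open>\<P>\<^sup>[\<^sup>k\<^sup>]\<close> for the box \<open>\<P>\<close> given by \<open>\<bar>z\<^sub>i\<bar> \<le> c i\<close> for all \<open>i < d\<close>.
\<close>

definition compound_box :: "nat \<Rightarrow> nat \<Rightarrow> (nat \<Rightarrow> real) \<Rightarrow> (nat set \<Rightarrow> real) set" where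
  "compound_box d k c =
    {Z \<in> exterior_power d k. \<forall>I. I \<subseteq> {..<d} \<and> card I = k \<longrightarrow> \<bar>Z I\<bar> \<le> (\<Prod>i\<in>I. c i)}"

definition theta_lattice :: "real mat \<Rightarrow> real vec set" where
  "theta_lattice \<Theta> = (let m = dim_col \<Theta>; n = dim_row \<Theta> in
    {four_block_mat (1\<^sub>m m) (0\<^sub>m m n) (- \<Theta>) (1\<^sub>m n) *\<^sub>v map_vec of_int z | z :: int vec.
       z \<in> carrier_vec (m + n)})"

text \<open>
  The weight \<open>\<rho> i\<close> belongs to row \<open>i\<close> of \<open>\<Theta>\<close>, as in the usual weighted exponent, where the
  \<open>i\<close>-th linear form is bounded by means of \<open>\<rho> i\<close>. The pairing matters: the exponents of the
  transpose attach \<open>\<rho> i\<close> to column \<open>i\<close> of the transpose, which is the same row of \<open>\<Theta>\<close>.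
  Attaching the weights to the last coordinates in reverse order, for \<open>\<Theta>\<close> and for its
  transpose alike, would pair row \<open>i\<close> with two different weights, and transference fails.
\<close>

definition box_sides ::
  "nat \<Rightarrow> (nat \<Rightarrow> real) \<Rightarrow> (nat \<Rightarrow> real) \<Rightarrow> real \<Rightarrow> real \<Rightarrow> nat \<Rightarrow> real" where
  "box_sides m \<sigma> \<rho> s \<gamma> i =
    (if i < m then exp (s * \<sigma> i) else exp (- (s * \<rho> (i - m) * \<gamma>)))"

definition Omega ::
  "nat \<Rightarrow> (nat \<Rightarrow> real) \<Rightarrow> (nat \<Rightarrow> real) \<Rightarrow> real mat \<Rightarrow> ereal" where
  "Omega k \<sigma> \<rho> \<Theta> = (let m = dim_col \<Theta>; d = dim_col \<Theta> + dim_row \<Theta> in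
    Sup {ereal \<gamma> | \<gamma>. \<forall>S. \<exists>s>S. \<exists>Z \<in> exterior_lattice d k (theta_lattice \<Theta>).
           Z \<noteq> 0 \<and> Z \<in> compound_box d k (box_sides m \<sigma> \<rho> s \<gamma>)})"

text \<open>
  The fraction \<open>((a - 1) + b w) / (a + (b - 1) w)\<close>, extended to \<open>w = \<infinity>\<close> by its limit
  (\<open>a \<ge> 1\<close>, \<open>b \<ge> 1\<close>); the arithmetic of type \<open>ereal\<close> would yield 0 there if \<open>b > 1\<close>.
  The value \<open>- \<infinity>\<close> is irrelevant, since by Minkowski's theorem the first exponent is at least 1.
\<close>

definition transference_bound :: "real \<Rightarrow> real \<Rightarrow> ereal \<Rightarrow> ereal" where
  "transference_bound a b w =
    (if w = \<infinity> then (if b = 1 then \<infinity> else ereal (b / (b - 1)))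
     else ereal (((a - 1) + b * real_of_ereal w) / (a + (b - 1) * real_of_ereal w)))"

end

theory Submission
  imports Defs
begin

text \<open>
  Every lattice has a basis \<open>b\<^sub>1, \<dots>, b\<^sub>p\<close> and weights \<open>r\<^sub>i > 0\<close> such that, up to a constant depending
  only on the dimension, \<open>b\<^sub>i\<close> has sup norm at most \<open>r\<^sub>i\<close> and the dual functional at most \<open>1 / r\<^sub>i\<close>. (Take
  a shortest vector, eliminate the coordinate where it is largest, recurse on the projected lattice and
  lift back with coefficients at most \<open>1/2\<close>.) If the box \<open>\<P>\<^sup>[\<^sup>k\<^sup>+\<^sup>1\<^sup>]\<close> contains a nonzero point of the
  exterior lattice, some integral coordinate with respect to the \<open>b\<^sub>J\<close> is nonzero, so the product of
  the \<open>r\<^sub>j\<close>, \<open>j \<in> J\<close>, is bounded. Omitting the largest factor keeps it bounded, which yields a nonzero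
  decomposable point in a multiple of \<open>\<P>\<^sup>[\<^sup>k\<^sup>]\<close>. Constants are absorbed by increasing \<open>s\<close> and decreasing \<open>\<gamma>\<close>, hence the
  exponents decrease in \<open>k\<close>, and the last one, for \<open>k = d\<close>, is at least 1. The final inequality
  follows by identifying the \<open>(d - 1)\<close>-st exterior power with the dual lattice, i.e. with the lattice of
  the transpose.
\<close>

section \<open>Reduced bases in the sup norm\<close>

text \<open>Only finitely many vectors of \<open>L\<close> are no longer than a given nonzero one,
  so the sup norm attains a minimum on the nonzero vectors. The coordinate \<open>h\<close> where
  the minimal vector attains its norm is recorded because it is the one to be eliminated.\<close>

lemma ex_shortest_vector:
  fixes L :: "(nat \<Rightarrow> real) set"
  assumes S: "finite S"
    and fin: "\<And>R. finite {x \<in> L. \<forall>j\<in>S. \<bar>x j\<bar> \<le> R}"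
    and supp: "\<And>x j. x \<in> L \<Longrightarrow> j \<notin> S \<Longrightarrow> x j = 0"
    and ne: "\<not> L \<subseteq> {0}"
  obtains b h where "b \<in> L" "h \<in> S" "b h \<noteq> 0" "\<And>j. \<bar>b j\<bar> \<le> \<bar>b h\<bar>"
    "\<And>x. x \<in> L \<Longrightarrow> (\<And>j. j \<in> S \<Longrightarrow> \<bar>x j\<bar> < \<bar>b h\<bar>) \<Longrightarrow> x = 0"
proof -
  define N where "N x = Max ((\<lambda>j. \<bar>x j\<bar>) ` S)" for x :: "nat \<Rightarrow> real"
  obtain y where y: "y \<in> L" "y \<noteq> 0" using ne by auto
  have S0: "S \<noteq> {}" using supp[OF y(1)] y(2) by (auto simp: fun_eq_iff)
  have N_ge: "\<bar>x j\<bar> \<le> N x" if "j \<in> S" for x j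
    unfolding N_def using S that by auto
  have N_in: "\<exists>j\<in>S. N x = \<bar>x j\<bar>" for x
  proof -
    have "N x \<in> (\<lambda>j. \<bar>x j\<bar>) ` S" unfolding N_def using S S0 by (intro Max_in) auto
    then show ?thesis by auto
  qed
  define T where "T = {x \<in> L. x \<noteq> 0 \<and> N x \<le> N y}"
  have "T \<subseteq> {x \<in> L. \<forall>j\<in>S. \<bar>x j\<bar> \<le> N y}"
    unfolding T_def using N_ge order_trans by blast
  then have "finite T" using fin finite_subset by blast
  moreover have "y \<in> T" using y by (simp add: T_def)
  ultimately obtain b where b: "b \<in> T" "\<And>x. x \<in> T \<Longrightarrow> N b \<le> N x"
    using arg_min_if_finite(1)[of T N] arg_min_least[of T _ N] by (metis empty_iff)
  obtain h where h: "h \<in> S" "N b = \<bar>b h\<bar>" using N_in by auto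
  have le: "\<bar>b j\<bar> \<le> \<bar>b h\<bar>" for j
    using N_ge[of j b] h supp[of b j] b(1) by (cases "j \<in> S") (auto simp: T_def)
  show ?thesis
  proof
    show "b \<in> L" using b(1) by (simp add: T_def)
    show "h \<in> S" by fact
    show "\<bar>b j\<bar> \<le> \<bar>b h\<bar>" for j by (rule le)
    show "b h \<noteq> 0"
    proof
      assume "b h = 0"
      then have "b j = 0" for j using le[of j] by simp
      then have "b = 0" by auto
      then show False using b(1) by (simp add: T_def)
    qed
    fix x assume x: "x \<in> L" "\<And>j. j \<in> S \<Longrightarrow> \<bar>x j\<bar> < \<bar>b h\<bar>"
    obtain j where j: "j \<in> S" "N x = \<bar>x j\<bar>" using N_in by auto
    have less: "N x < N b" using x(2)[OF j(1)] j(2) h(2) by simp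
    then have "x \<notin> T" using b(2) by force
    moreover have "N x \<le> N y" using less b(2)[OF \<open>y \<in> T\<close>] by simp
    ultimately show "x = 0" using x(1) by (simp add: T_def)
  qed
qed

lemma subgroup_int_mult:
  fixes L :: "('a \<Rightarrow> real) set"
  assumes "0 \<in> L" and "\<And>x y. x \<in> L \<Longrightarrow> y \<in> L \<Longrightarrow> x - y \<in> L" and "x \<in> L"
  shows "(\<lambda>j. of_int t * x j) \<in> L"
proof -
  have neg: "(\<lambda>j. - y j) \<in> L" if "y \<in> L" for y
    using assms(2)[OF assms(1) that] by (simp add: fun_diff_def)
  have nat: "(\<lambda>j. of_nat k * x j) \<in> L" for k
  proof (induction k)
    case 0 then show ?case using assms(1) by (simp add: zero_fun_def)
  next
    case (Suc k)
    show ?case using assms(2)[OF Suc neg[OF assms(3)]] by (simp add: fun_diff_def algebra_simps)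
  qed
  show ?thesis
  proof (cases "t \<ge> 0")
    case True
    then show ?thesis using nat[of "nat t"] by simp
  next
    case False
    then show ?thesis using neg[OF nat[of "nat (-t)"]] by simp
  qed
qed

lemma subgroup_sum:
  fixes L :: "('a \<Rightarrow> real) set"
  assumes "0 \<in> L" and "\<And>x y. x \<in> L \<Longrightarrow> y \<in> L \<Longrightarrow> x - y \<in> L"
    and "finite A" and "\<And>i. i \<in> A \<Longrightarrow> v i \<in> L"
  shows "(\<lambda>j. \<Sum>i\<in>A. v i j) \<in> L"
  using assms(3,4)
proof (induction A rule: finite_induct)
  case empty
  then show ?case using assms(1) by (simp add: zero_fun_def)
next
  case (insert i A)
  have "v i - (0 - (\<lambda>j. \<Sum>i\<in>A. v i j)) \<in> L"
    using insert by (intro assms(2) assms(1)) auto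
  also have "v i - (0 - (\<lambda>j. \<Sum>i\<in>A. v i j)) = (\<lambda>j. \<Sum>i\<in>insert i A. v i j)"
    using insert by (auto simp: fun_eq_iff)
  finally show ?case .
qed

text \<open>The bounds express near orthogonality: \<open>b i\<close> has size about
  \<open>r i\<close>, and its dual functional, given by the coefficient vector \<open>F i\<close>,
  has size about \<open>1 / r i\<close>. The last clause makes \<open>L\<close> lie in the integral
  span of the \<open>b i\<close>. The bound on \<open>p\<close> limits the number of summands in
  later estimates.\<close>

definition reduced_basis ::
  "nat set \<Rightarrow> real \<Rightarrow> (nat \<Rightarrow> real) set \<Rightarrow> nat \<Rightarrow> (nat \<Rightarrow> nat \<Rightarrow> real) \<Rightarrow>
    (nat \<Rightarrow> nat \<Rightarrow> real) \<Rightarrow> (nat \<Rightarrow> real) \<Rightarrow> bool" where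
  "reduced_basis S C L p b F r \<longleftrightarrow>
    p \<le> card S \<and>
    (\<forall>i<p. b i \<in> L \<and> r i > 0 \<and> (\<forall>j\<in>S. \<bar>b i j\<bar> \<le> C * r i \<and> \<bar>F i j\<bar> \<le> C / r i)) \<and>
    (\<forall>i<p. \<forall>k<p. (\<Sum>j\<in>S. F i j * b k j) = (if i = k then 1 else 0)) \<and>
    (\<forall>x\<in>L. (\<forall>i<p. (\<Sum>j\<in>S. F i j * x j) \<in> \<int>) \<and>
      (\<forall>j\<in>S. x j = (\<Sum>i<p. (\<Sum>j\<in>S. F i j * x j) * b i j)))"

text \<open>Vectors are functions supported in \<open>S\<close>, so that a coordinate can be
  eliminated without renumbering the others.\<close>

definition discrete_subgroup :: "nat set \<Rightarrow> (nat \<Rightarrow> real) set \<Rightarrow> bool" where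
  "discrete_subgroup S L \<longleftrightarrow>
    0 \<in> L \<and> (\<forall>x\<in>L. \<forall>y\<in>L. x - y \<in> L) \<and> (\<forall>x\<in>L. \<forall>j. j \<notin> S \<longrightarrow> x j = 0) \<and>
    (\<forall>R. finite {x \<in> L. \<forall>j\<in>S. \<bar>x j\<bar> \<le> R})"

text \<open>The constant is chosen before \<open>S\<close> and \<open>L\<close>, because the result
  is applied to lattices rescaled by boxes that vary with \<open>s\<close>. The induction removes
  one coordinate at a time.\<close>

lemma reduced_basis_exists:
  "\<exists>C\<ge>1. \<forall>S L. finite S \<longrightarrow> card S = d \<longrightarrow> discrete_subgroup S L \<longrightarrow>
     (\<exists>p b F r. reduced_basis S C L p b F r)"
proof (induction d)
  case 0
  show ?case
    by (rule exI[of _ 1]) (auto simp: reduced_basis_def intro!: exI[of _ "0::nat"])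
next
  case (Suc d)
  then obtain C where C: "C \<ge> 1" and IH: "\<forall>S L. finite S \<longrightarrow> card S = d \<longrightarrow>
     discrete_subgroup S L \<longrightarrow> (\<exists>p b F r. reduced_basis S C L p b F r)"
    by (elim exE conjE)
  \<comment> \<open>The worst estimate is that of the functional dual to the shortest vector: 1
    comes from its entry \<open>1 / e h\<close>, the rest from at most \<open>d\<close> corrections,
    each bounded by \<open>real (Suc d) * C * (2 * C) / r0\<close>.\<close>
  define K where "K = 1 + real (Suc d) * (real (Suc d) * C) * (2 * C)"
  have K_ge: "2 * C \<le> K" "real (Suc d) * C \<le> K" "1 \<le> K" "C \<le> K"
  proof -
    have D: "real (Suc d) \<ge> 1" by simp
    have CC: "C * 1 \<le> C * C" using C by (intro mult_left_mono) auto
    have "1 * 1 \<le> real (Suc d) * real (Suc d)" using D by (intro mult_mono) auto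
    then have "1 * (C * C) \<le> real (Suc d) * real (Suc d) * (C * C)"
      using C by (intro mult_right_mono) auto
    moreover have "real (Suc d) * (1 * C) \<le> real (Suc d) * (real (Suc d) * (C * C))"
      using C D CC by (intro mult_left_mono mult_mono) auto
    moreover have "real (Suc d) * C \<ge> 0" using C by simp
    moreover have "K = 1 + 2 * (real (Suc d) * real (Suc d) * (C * C))"
      by (simp add: K_def algebra_simps)
    ultimately show "2 * C \<le> K" "real (Suc d) * C \<le> K" "1 \<le> K" "C \<le> K"
      using C CC unfolding mult.assoc by linarith+
  qed
  show ?case
  proof (intro exI[of _ K] conjI allI impI)
    show "1 \<le> K" by fact
    fix S :: "nat set" and L :: "(nat \<Rightarrow> real) set"
    assume S: "finite S" "card S = Suc d" and "discrete_subgroup S L"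
    then have L0: "0 \<in> L"
      and Ld: "\<forall>x\<in>L. \<forall>y\<in>L. x - y \<in> L" and supp: "\<forall>x\<in>L. \<forall>j. j \<notin> S \<longrightarrow> x j = 0"
      and fin: "\<forall>R. finite {x \<in> L. \<forall>j\<in>S. \<bar>x j\<bar> \<le> R}"
      by (simp_all add: discrete_subgroup_def)
    show "\<exists>p b F r. reduced_basis S K L p b F r"
    proof (cases "L \<subseteq> {0}")
      case True
      then have "L = {0}" using L0 by auto
      then show ?thesis
        by (auto simp: reduced_basis_def intro!: exI[of _ "0::nat"])
    next
      case False
      obtain e h where e: "e \<in> L" "h \<in> S" "e h \<noteq> 0" "\<And>j. \<bar>e j\<bar> \<le> \<bar>e h\<bar>"
        "\<And>x. x \<in> L \<Longrightarrow> (\<And>j. j \<in> S \<Longrightarrow> \<bar>x j\<bar> < \<bar>e h\<bar>) \<Longrightarrow> x = 0"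
        by (rule ex_shortest_vector[of S L]) (use S(1) fin supp False in auto)
      define r0 where "r0 = \<bar>e h\<bar>"
      have r0: "r0 > 0" using e(3) by (simp add: r0_def)
      define S' where "S' = S - {h}"
      have S': "finite S'" "card S' = d" "S = insert h S'" "h \<notin> S'"
        using S e(2) by (auto simp: S'_def)
      \<comment> \<open>Projection along the shortest vector \<open>e\<close> onto the hyperplane
        where coordinate \<open>h\<close> vanishes.\<close>
      define P where "P x = (\<lambda>j. x j - x h / e h * e j)" for x
      have Ph: "P x h = 0" for x using e(3) by (simp add: P_def)
      define L' where "L' = P ` L"
      \<comment> \<open>Preimages differ by multiples of \<open>e\<close>; subtracting the nearest
        integer multiple leaves a component along \<open>e\<close> of at most half of
        \<open>e\<close>.\<close>
      have lift: "\<exists>y\<in>L. P y = z \<and> \<bar>y h / e h\<bar> \<le> 1/2" if z: "z \<in> L'" for z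
      proof -
        obtain x where x: "x \<in> L" "P x = z" using z unfolding L'_def by blast
        define t where "t = round (x h / e h)"
        let ?y = "x - (\<lambda>j. of_int t * e j)"
        have "?y \<in> L" using Ld x(1) subgroup_int_mult[OF L0 _ e(1), of t] by blast
        moreover have "P ?y = z"
          unfolding x(2)[symmetric] P_def using e(3) by (auto simp: fun_eq_iff field_simps)
        moreover have "?y h / e h = - (of_int t - x h / e h)" using e(3) by (simp add: field_simps)
        then have "\<bar>?y h / e h\<bar> \<le> 1/2"
          using of_int_round_abs_le[of "x h / e h"] unfolding t_def by linarith
        ultimately show ?thesis by blast
      qed
      have half: "\<bar>t * e j\<bar> \<le> r0 / 2" if "\<bar>t\<bar> \<le> 1/2" for t j
        using mult_mono[OF that e(4)[of j]] by (simp add: abs_mult r0_def)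
      have Pinv: "x j = P x j + x h / e h * e j" for x j by (simp add: P_def)
      have L'0: "0 \<in> L'"
        unfolding L'_def by (rule image_eqI[OF _ L0]) (simp add: P_def fun_eq_iff)
      have L'd: "\<forall>x\<in>L'. \<forall>y\<in>L'. x - y \<in> L'"
      proof (intro ballI)
        fix x y assume "x \<in> L'" "y \<in> L'"
        then obtain u v where "u \<in> L" "v \<in> L" "x = P u" "y = P v" unfolding L'_def by blast
        moreover have "P u - P v = P (u - v)"
          by (auto simp: P_def fun_eq_iff algebra_simps diff_divide_distrib)
        ultimately show "x - y \<in> L'" unfolding L'_def using Ld by auto
      qed
      have supp': "\<forall>x\<in>L'. \<forall>j. j \<notin> S' \<longrightarrow> x j = 0"
      proof (intro ballI allI impI)
        fix x j assume "x \<in> L'" and j: "j \<notin> S'"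
        then obtain u where u: "u \<in> L" "x = P u" unfolding L'_def by blast
        show "x j = 0"
        proof (cases "j = h")
          case False
          then have "j \<notin> S" using j S' by auto
          then have "u j = 0" "e j = 0" using supp u(1) e(1) by blast+
          then show ?thesis by (simp add: u(2) P_def)
        qed (use Ph u in simp)
      qed
      have fin': "\<forall>R. finite {x \<in> L'. \<forall>j\<in>S'. \<bar>x j\<bar> \<le> R}"
      proof
        fix R
        \<comment> \<open>Discreteness survives the projection because bounded points of
          \<open>L'\<close> have bounded lifts.\<close>
        have "{x \<in> L'. \<forall>j\<in>S'. \<bar>x j\<bar> \<le> R} \<subseteq> P ` {y \<in> L. \<forall>j\<in>S. \<bar>y j\<bar> \<le> \<bar>R\<bar> + r0 / 2}"
        proof
          fix x assume x: "x \<in> {x \<in> L'. \<forall>j\<in>S'. \<bar>x j\<bar> \<le> R}"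
          then obtain y where y: "y \<in> L" "P y = x" "\<bar>y h / e h\<bar> \<le> 1/2" using lift by blast
          have "\<bar>y j\<bar> \<le> \<bar>R\<bar> + r0 / 2" if "j \<in> S" for j
          proof -
            have "\<bar>x j\<bar> \<le> \<bar>R\<bar>" using x that S'(3) Ph[of y] y(2) by force
            then show ?thesis using Pinv[of y j] half[OF y(3), of j] unfolding y(2) by linarith
          qed
          then show "x \<in> P ` {y \<in> L. \<forall>j\<in>S. \<bar>y j\<bar> \<le> \<bar>R\<bar> + r0 / 2}" using y by blast
        qed
        then show "finite {x \<in> L'. \<forall>j\<in>S'. \<bar>x j\<bar> \<le> R}"
          by (rule finite_subset) (intro finite_imageI fin[rule_format])
      qed
      have "discrete_subgroup S' L'"
        unfolding discrete_subgroup_def using L'0 L'd supp' fin' by (intro conjI)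
      then obtain p b' F' r where red: "reduced_basis S' C L' p b' F' r"
        using IH S'(1,2) by blast
      have pd: "p \<le> d" using red S'(2) by (simp add: reduced_basis_def)
      have b'L: "b' i \<in> L'" and r: "r i > 0" and b'_le: "j \<in> S' \<Longrightarrow> \<bar>b' i j\<bar> \<le> C * r i"
        and F'_le: "j \<in> S' \<Longrightarrow> \<bar>F' i j\<bar> \<le> C / r i" if "i < p" for i j
        using red that by (auto simp: reduced_basis_def)
      have dual': "(\<Sum>j\<in>S'. F' i j * b' k j) = (if i = k then 1 else 0)" if "i < p" "k < p" for i k
        using red that by (auto simp: reduced_basis_def)
      have int': "(\<Sum>j\<in>S'. F' i j * x j) \<in> \<int>" if "x \<in> L'" "i < p" for x i
        using red that unfolding reduced_basis_def by blast
      have exp': "x j = (\<Sum>i<p. (\<Sum>j\<in>S'. F' i j * x j) * b' i j)" if "x \<in> L'" "j \<in> S'" for x j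
        using red that unfolding reduced_basis_def by blast
      have "\<forall>i. \<exists>y. i < p \<longrightarrow> y \<in> L \<and> P y = b' i \<and> \<bar>y h / e h\<bar> \<le> 1/2" using lift b'L by blast
      then obtain v where v: "\<And>i. i < p \<Longrightarrow> v i \<in> L" "\<And>i. i < p \<Longrightarrow> P (v i) = b' i"
          "\<And>i. i < p \<Longrightarrow> \<bar>v i h / e h\<bar> \<le> 1/2" by metis
      define t where "t i = v i h / e h" for i
      have v_eq: "v i j = b' i j + t i * e j" if "i < p" for i j
        using Pinv[of "v i" j] v(2)[OF that] by (simp add: t_def)
      have t_half: "\<bar>t i * e j\<bar> \<le> r0 / 2" if "i < p" for i j
        using half[OF v(3)[OF that], of j] by (simp only: t_def)
      \<comment> \<open>Were \<open>r i\<close> smaller, both \<open>b' i\<close> and the component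
        of \<open>v i\<close> along \<open>e\<close> would have norm at most \<open>r0 / 2\<close>,
        the former strictly less. Then \<open>v i\<close> would be shorter than the shortest vector,
        hence zero.\<close>
      have r_ge: "r0 \<le> 2 * C * r i" if "i < p" for i
      proof (rule ccontr)
        assume "\<not> r0 \<le> 2 * C * r i"
        then have lt: "C * r i < r0 / 2" by simp
        have "\<bar>v i j\<bar> < \<bar>e h\<bar>" if j: "j \<in> S" for j
        proof -
          have "\<bar>b' i j\<bar> \<le> C * r i"
            using b'_le[OF \<open>i < p\<close>, of j] j S'(3) Ph[of "v i"] v(2)[OF \<open>i < p\<close>] r[OF \<open>i < p\<close>] C
            by auto
          then show ?thesis
            using lt v_eq[OF \<open>i < p\<close>, of j] t_half[OF \<open>i < p\<close>, of j]
            unfolding r0_def[symmetric] by linarith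
        qed
        then have "v i = 0" using e(5)[OF v(1)[OF that]] by blast
        then have "b' i = 0" using v(2)[OF that] by (auto simp: P_def fun_eq_iff)
        then show False using dual'[OF that that] by simp
      qed
      \<comment> \<open>The coefficient vector of the functional \<open>F' i\<close> composed with
        \<open>P\<close>; the entry at \<open>h\<close> accounts for the projection.\<close>
      define F0 where "F0 i j = (if j = h then - (\<Sum>l\<in>S'. F' i l * e l) / e h else F' i j)" for i j
      define b where "b i = (if i < p then v i else e)" for i
      \<comment> \<open>The vector \<open>e\<close> gets the index \<open>p\<close>. Its coefficient
        is \<open>x h / e h\<close> minus what the lifts contribute, since \<open>v l\<close> has
        the coordinate \<open>t l * e h\<close> at \<open>h\<close>.\<close>
      define F where "F i j = (if i < p then F0 i j
        else (if j = h then 1 / e h else 0) - (\<Sum>l<p. t l * F0 l j))" for i j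
      define r1 where "r1 i = (if i < p then r i else r0)" for i
      have F0_app: "(\<Sum>j\<in>S. F0 i j * x j) = (\<Sum>j\<in>S'. F' i j * P x j)" for i x
      proof -
        have "(\<Sum>j\<in>S. F0 i j * x j) = F0 i h * x h + (\<Sum>j\<in>S'. F0 i j * x j)"
          using S' by simp
        also have "(\<Sum>j\<in>S'. F0 i j * x j) = (\<Sum>j\<in>S'. F' i j * x j)"
          using S' by (intro sum.cong) (auto simp: F0_def)
        also have "F0 i h * x h = - (\<Sum>l\<in>S'. F' i l * (x h / e h * e l))"
          by (simp add: F0_def sum_distrib_right sum_distrib_left sum_divide_distrib sum_negf mult_ac
              flip: sum_negf)
        finally show ?thesis by (simp add: P_def algebra_simps sum_subtractf)
      qed
      have F_app: "(\<Sum>j\<in>S. F p j * x j) = x h / e h - (\<Sum>l<p. t l * (\<Sum>j\<in>S'. F' l j * P x j))" for x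
      proof -
        have "(\<Sum>j\<in>S. F p j * x j) = (\<Sum>j\<in>S. (if j = h then x h / e h else 0) - (\<Sum>l<p. t l * (F0 l j * x j)))"
          by (intro sum.cong) (auto simp: F_def algebra_simps sum_distrib_left)
        also have "\<dots> = x h / e h - (\<Sum>j\<in>S. \<Sum>l<p. t l * (F0 l j * x j))"
          using S e(2) by (simp add: sum_subtractf)
        also have "(\<Sum>j\<in>S. \<Sum>l<p. t l * (F0 l j * x j)) = (\<Sum>l<p. t l * (\<Sum>j\<in>S. F0 l j * x j))"
          by (subst sum.swap) (simp add: sum_distrib_left)
        finally show ?thesis by (simp add: F0_app)
      qed
      have Pe: "P e = 0" using e(3) by (simp add: P_def fun_eq_iff)
      have F0_le: "\<bar>F0 i j\<bar> \<le> real (Suc d) * C / r i" if "i < p" "j \<in> S" for i j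
      proof (cases "j = h")
        case True
        have "\<bar>F0 i j\<bar> = \<bar>\<Sum>l\<in>S'. F' i l * (e l / e h)\<bar>"
          using True by (simp add: F0_def sum_divide_distrib)
        also have "\<dots> \<le> (\<Sum>l\<in>S'. \<bar>F' i l * (e l / e h)\<bar>)" by (rule sum_abs)
        also have "\<dots> \<le> (\<Sum>l\<in>S'. C / r i)"
        proof (rule sum_mono)
          fix l assume l: "l \<in> S'"
          \<comment> \<open>Eliminating the largest coordinate of \<open>e\<close> is what keeps
            this quotient bounded.\<close>
          have "\<bar>e l / e h\<bar> \<le> 1" using e(3,4) by (simp add: abs_divide divide_simps)
          then show "\<bar>F' i l * (e l / e h)\<bar> \<le> C / r i"
            unfolding abs_mult using F'_le[OF that(1) l] mult_mono[of _ "C / r i" _ 1] C r[OF that(1)] by force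
        qed
        also have "\<dots> \<le> real (Suc d) * C / r i"
          using S'(2) C r[OF that(1)] by (simp add: divide_simps)
        finally show ?thesis .
      next
        case False
        then have "\<bar>F0 i j\<bar> \<le> C / r i" using F'_le[OF that(1)] that(2) S'(3) by (auto simp: F0_def)
        also have "\<dots> \<le> real (Suc d) * C / r i"
          using C r[OF that(1)] by (simp add: divide_simps)
        finally show ?thesis .
      qed
      have "reduced_basis S K L (Suc p) b F r1"
        unfolding reduced_basis_def
      proof (intro conjI allI impI ballI)
        show "Suc p \<le> card S" using pd S by simp
        show "b i \<in> L" for i using v(1) e(1) by (simp add: b_def)
        show "0 < r1 i" for i using r r0 by (simp add: r1_def)
        show "\<bar>b i j\<bar> \<le> K * r1 i" if "j \<in> S" for i j
        proof (cases "i < p")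
          case True
          have "\<bar>b' i j\<bar> \<le> C * r i"
            using b'_le[OF True, of j] that S'(3) Ph[of "v i"] v(2)[OF True] r[OF True] C by auto
          then have "\<bar>v i j\<bar> \<le> 2 * C * r i"
            using v_eq[OF True, of j] t_half[OF True, of j] r_ge[OF True] by linarith
          also have "\<dots> \<le> K * r i" using K_ge r[OF True] by (intro mult_right_mono) auto
          finally show ?thesis using True by (simp add: b_def r1_def)
        next
          case False
          have "r0 \<le> K * r0" using K_ge r0 by simp
          then show ?thesis using False e(4)[of j] by (simp add: b_def r1_def r0_def)
        qed
        show "\<bar>F i j\<bar> \<le> K / r1 i" if "j \<in> S" for i j
        proof (cases "i < p")
          case True
          have "\<bar>F0 i j\<bar> \<le> real (Suc d) * C / r i" by (rule F0_le[OF True that])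
          also have "\<dots> \<le> K / r i" using K_ge r[OF True] by (intro divide_right_mono) auto
          finally show ?thesis using True by (simp add: F_def r1_def)
        next
          case False
          \<comment> \<open>The minimality of \<open>e\<close>, in the form \<open>r_ge\<close>,
            turns the bound in \<open>1 / r l\<close> into one in \<open>1 / r0\<close>.\<close>
          have *: "\<bar>t l * F0 l j\<bar> \<le> real (Suc d) * C * (2 * C) / r0" if l: "l < p" for l
          proof -
            have "\<bar>t l * F0 l j\<bar> \<le> 1 * (real (Suc d) * C / r l)"
              unfolding abs_mult
            proof (rule mult_mono)
              show "\<bar>t l\<bar> \<le> 1" using v(3)[OF l] unfolding t_def by linarith
            qed (use F0_le[OF l \<open>j \<in> S\<close>] in auto)
            also have "\<dots> = real (Suc d) * C * (1 / r l)" by simp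
            also have "\<dots> \<le> real (Suc d) * C * (2 * C / r0)"
              using r_ge[OF l] r[OF l] r0 C by (intro mult_left_mono) (auto simp: field_simps)
            finally show ?thesis by simp
          qed
          have "\<bar>F i j\<bar> \<le> \<bar>if j = h then 1 / e h else 0\<bar> + \<bar>\<Sum>l<p. t l * F0 l j\<bar>"
            using False by (simp add: F_def)
          also have "\<dots> \<le> 1 / r0 + (\<Sum>l<p. real (Suc d) * C * (2 * C) / r0)"
          proof (rule add_mono)
            show "\<bar>if j = h then 1 / e h else 0\<bar> \<le> 1 / r0" using r0 by (auto simp: r0_def)
            show "\<bar>\<Sum>l<p. t l * F0 l j\<bar> \<le> (\<Sum>l<p. real (Suc d) * C * (2 * C) / r0)"
              by (rule order_trans[OF sum_abs sum_mono]) (use * in auto)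
          qed
          also have "\<dots> \<le> 1 / r0 + real (Suc d) * (real (Suc d) * C * (2 * C) / r0)"
            using pd C r0 by (simp del: of_nat_Suc) (intro divide_right_mono mult_right_mono, auto)
          also have "\<dots> = K / r0" by (simp add: K_def add_divide_distrib)
          finally show ?thesis using False by (simp add: r1_def)
        qed
        show "(\<Sum>j\<in>S. F i j * b k j) = (if i = k then 1 else 0)" if ik: "i < Suc p" "k < Suc p" for i k
        proof -
          consider "i < p" "k < p" | "i < p" "k = p" | "i = p" "k < p" | "i = p" "k = p"
            using ik by linarith
          then show ?thesis
          proof cases
            case 1
            then show ?thesis using F0_app[of i "v k"] v(2)[of k] dual'[of i k] by (simp add: F_def b_def)
          next
            case 2
            then show ?thesis using F0_app[of i e] Pe by (simp add: F_def b_def)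
          next
            case 3
            have "(\<Sum>l<p. t l * (\<Sum>j\<in>S'. F' l j * b' k j)) = (\<Sum>l<p. if l = k then t l else 0)"
              using 3 by (intro sum.cong) (auto simp: dual')
            also have "\<dots> = t k" using 3 by simp
            finally show ?thesis using 3 F_app[of "v k"] v(2)[of k] by (simp add: b_def t_def)
          next
            case 4
            then show ?thesis using F_app[of e] Pe e(3) by (simp add: b_def)
          qed
        qed
        fix x assume x: "x \<in> L"
        have PxL: "P x \<in> L'" using x by (simp add: L'_def)
        define c where "c i = (\<Sum>j\<in>S. F i j * x j)" for i
        have c: "c i = (\<Sum>j\<in>S'. F' i j * P x j)" if "i < p" for i
          using F0_app[of i x] that by (simp add: c_def F_def)
        have cp: "c p = x h / e h - (\<Sum>l<p. t l * c l)"
          unfolding c_def F_app using c by (simp add: c_def)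
        have P_sum: "P x j = (\<Sum>i<p. c i * b' i j)" if "j \<in> S" for j
        proof (cases "j = h")
          case True
          have "b' i h = 0" if "i < p" for i using Ph[of "v i"] v(2)[OF that] by simp
          then show ?thesis using True Ph by simp
        next
          case False
          then show ?thesis using exp'[OF PxL, of j] that S'(3) c by simp
        qed
        have main: "x j = (\<Sum>i<p. c i * v i j) + c p * e j" if "j \<in> S" for j
        proof -
          have "(\<Sum>i<p. c i * v i j) = P x j + (\<Sum>i<p. t i * c i) * e j"
            unfolding P_sum[OF that] sum_distrib_right sum.distrib[symmetric]
            by (intro sum.cong) (auto simp: v_eq algebra_simps)
          then show ?thesis using Pinv[of x j] by (simp add: cp algebra_simps)
        qed
        show "x j = (\<Sum>i<Suc p. (\<Sum>j\<in>S. F i j * x j) * b i j)" if "j \<in> S" for j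
          using main[OF that] by (simp add: b_def flip: c_def)
        have cint: "c i \<in> \<int>" if "i < p" for i using int'[OF PxL that] c[OF that] by simp
        \<comment> \<open>Subtracting the integral combination of the \<open>v i\<close> and the
          nearest integer multiple of \<open>e\<close> from \<open>x\<close> leaves a lattice vector
          that is at most half of \<open>e\<close>; it is shorter than \<open>e\<close> and
          therefore zero.\<close>
        have "c p \<in> \<int>"
        proof -
          define t0 where "t0 = round (c p)"
          have 1: "(\<lambda>j. \<Sum>i<p. c i * v i j) \<in> L"
          proof (rule subgroup_sum[OF L0])
            fix i assume "i \<in> {..<p}"
            then have "i < p" by simp
            then obtain q where "c i = of_int q" "v i \<in> L" using cint[of i] v(1)[of i] Ints_cases[of "c i"] by blast
            then show "(\<lambda>j. c i * v i j) \<in> L" using subgroup_int_mult[OF L0 _ \<open>v i \<in> L\<close>, of q] Ld by simp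
          qed (use Ld in auto)
          define z where "z = x - (\<lambda>j. \<Sum>i<p. c i * v i j) - (\<lambda>j. of_int t0 * e j)"
          have "z \<in> L" unfolding z_def
            using Ld x 1 subgroup_int_mult[OF L0 _ e(1), of t0] by blast
          have zj: "z j = (c p - of_int t0) * e j" if "j \<in> S" for j
            using main[OF that] by (simp add: z_def algebra_simps)
          have t0: "\<bar>c p - of_int t0\<bar> \<le> 1/2"
            using of_int_round_abs_le[of "c p"] unfolding t0_def by (simp add: abs_minus_commute)
          have "\<bar>z j\<bar> < \<bar>e h\<bar>" if "j \<in> S" for j
            using half[OF t0, of j] zj[OF that] r0 by (simp add: r0_def)
          then have "z = 0" using e(5)[OF \<open>z \<in> L\<close>] by blast
          then have "c p = of_int t0" using zj[OF e(2)] e(3) by simp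
          then show ?thesis by simp
        qed
        then show "(\<Sum>j\<in>S. F i j * x j) \<in> \<int>" if "i < Suc p" for i
          using cint[of i] that unfolding c_def[symmetric] by (cases "i = p") auto
      qed
      then show ?thesis by blast
    qed
  qed
qed

section \<open>The Cauchy--Binet formula\<close>

definition index_sets :: "nat \<Rightarrow> nat \<Rightarrow> nat set set" where
  "index_sets d k = {I. I \<subseteq> {..<d} \<and> card I = k}"

lemma finite_index_sets [simp]: "finite (index_sets d k)"
  unfolding index_sets_def by (rule finite_subset[of _ "Pow {..<d}"]) auto

lemma bij_betw_pick: "finite I \<Longrightarrow> bij_betw (pick I) {0..<card I} I"
proof -
  assume I: "finite I"
  have inj: "inj_on (pick I) {0..<card I}"
    by (rule linorder_inj_onI') (use pick_mono_le in force)
  have "pick I ` {0..<card I} \<subseteq> I" using pick_in_set_le by auto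
  then have "pick I ` {0..<card I} = I"
    using I inj by (intro card_subset_eq) (auto simp: card_image)
  then show ?thesis using inj by (simp add: bij_betw_def)
qed

text \<open>An injective choice of indices is the increasing enumeration of its image up to a
  permutation; this sorts the terms of the Cauchy--Binet expansion.\<close>

lemma inj_on_factor_pick:
  assumes g: "inj_on g {0..<k}" and I: "g ` {0..<k} = I"
  obtains q where "q permutes {0..<k}" "\<And>l. l < k \<Longrightarrow> g l = pick I (q l)"
proof -
  have fin: "finite I" and card: "card I = k" using g by (auto simp: card_image simp flip: I)
  have bp: "bij_betw (pick I) {0..<k} I" using bij_betw_pick[OF fin] card by simp
  have bg: "bij_betw g {0..<k} I" using g I by (simp add: bij_betw_def)
  define q where "q l = (if l \<in> {0..<k} then inv_into {0..<k} (pick I) (g l) else l)" for l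
  have "bij_betw (inv_into {0..<k} (pick I) \<circ> g) {0..<k} {0..<k}"
    using bij_betw_trans[OF bg bij_betw_inv_into[OF bp]] .
  then have "bij_betw q {0..<k} {0..<k}"
    by (rule bij_betw_cong[THEN iffD1, rotated]) (simp add: q_def)
  then have "q permutes {0..<k}" by (rule bij_imp_permutes) (auto simp: q_def)
  moreover have "g l = pick I (q l)" if "l < k" for l
  proof -
    have "g l \<in> I" using bg that by (auto simp: bij_betw_def)
    then show ?thesis using that bp by (simp add: q_def bij_betw_inv_into_right)
  qed
  ultimately show ?thesis using that by blast
qed

lemma det_col_fun:
  "det (mat k k (\<lambda>(a, l). M a l)) =
     (\<Sum>p | p permutes {0..<k}. signof p * (\<Prod>l<k. M (p l) l :: 'a :: comm_ring_1))"
proof -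
  have "p l < k" if "p permutes {0..<k}" "l < k" for p l
    using permutes_in_image[OF that(1), of l] that(2) by simp
  then show ?thesis by (subst det_col[of _ k]) (auto intro!: sum.cong prod.cong)
qed

text \<open>Expanding every column by multilinearity gives a sum over all choices \<open>g\<close>
  of one index per column. A repeated index gives equal columns and contributes nothing. The
  injective choices are grouped by their image \<open>I\<close>; sorting them produces the signs of
  the second minor.\<close>

lemma cauchy_binet:
  fixes A B :: "nat \<Rightarrow> nat \<Rightarrow> 'a :: comm_ring_1"
  shows "det (mat k k (\<lambda>(a, l). \<Sum>j<d. A a j * B j l)) =
    (\<Sum>I\<in>index_sets d k. det (mat k k (\<lambda>(a, c). A a (pick I c))) *
       det (mat k k (\<lambda>(c, l). B (pick I c) l)))"
proof -
  define G where "G = {..<k} \<rightarrow>\<^sub>E {..<d}"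
  define D where "D g = det (mat k k (\<lambda>(a, l). A a (g l)))" for g
  have finG: "finite G" by (simp add: G_def finite_PiE)
  have "det (mat k k (\<lambda>(a, l). \<Sum>j<d. A a j * B j l)) =
      (\<Sum>p | p permutes {0..<k}. signof p * (\<Sum>g\<in>G. \<Prod>l<k. A (p l) (g l) * B (g l) l))"
    unfolding det_col_fun G_def by (subst prod_sum_PiE) simp_all
  also have "\<dots> = (\<Sum>g\<in>G. D g * (\<Prod>l<k. B (g l) l))"
    unfolding D_def det_col_fun sum_distrib_left sum_distrib_right
    by (subst sum.swap) (simp add: prod.distrib mult_ac)
  also have "\<dots> = (\<Sum>g | g \<in> G \<and> inj_on g {0..<k}. D g * (\<Prod>l<k. B (g l) l))"
  proof (rule sum.mono_neutral_right[OF finG])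
    show "\<forall>g\<in>G - {g. g \<in> G \<and> inj_on g {0..<k}}. D g * (\<Prod>l<k. B (g l) l) = 0"
    proof
      fix g assume "g \<in> G - {g. g \<in> G \<and> inj_on g {0..<k}}"
      then obtain i j where ij: "i < k" "j < k" "i \<noteq> j" "g i = g j" by (auto simp: inj_on_def)
      have "D g = 0"
        unfolding D_def by (rule det_identical_columns[OF _ ij(3,1,2)]) (use ij in auto)
      then show "D g * (\<Prod>l<k. B (g l) l) = 0" by simp
    qed
  qed auto
  also have "\<dots> = (\<Sum>I\<in>index_sets d k. \<Sum>g | g \<in> G \<and> inj_on g {0..<k} \<and> g ` {0..<k} = I.
      D g * (\<Prod>l<k. B (g l) l))"
  proof -
    have "(\<lambda>g. g ` {0..<k}) ` {g \<in> G. inj_on g {0..<k}} \<subseteq> index_sets d k"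
    proof (rule image_subsetI)
      fix g assume g: "g \<in> {g \<in> G. inj_on g {0..<k}}"
      then have "g l < d" if "l < k" for l using that PiE_mem[of g "{..<k}" "\<lambda>_. {..<d}" l] by (simp add: G_def)
      then show "g ` {0..<k} \<in> index_sets d k" using g by (auto simp: index_sets_def card_image)
    qed
    from sum.group[OF _ _ this, of "\<lambda>g. D g * (\<Prod>l<k. B (g l) l)"] show ?thesis
      using finG by (simp add: conj_assoc)
  qed
  also have "\<dots> = (\<Sum>I\<in>index_sets d k. det (mat k k (\<lambda>(a, c). A a (pick I c))) *
       det (mat k k (\<lambda>(c, l). B (pick I c) l)))"
  proof (rule sum.cong[OF refl])
    fix I assume "I \<in> index_sets d k"
    then have I: "I \<subseteq> {..<d}" "card I = k" "finite I"
      by (auto simp: index_sets_def intro: finite_subset)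
    have bp: "bij_betw (pick I) {0..<k} I" using bij_betw_pick[OF I(3)] I(2) by simp
    \<comment> \<open>The restriction is required because the members of \<open>G\<close> are
      extensional functions.\<close>
    let ?h = "\<lambda>q. restrict (\<lambda>l. pick I (q l)) {..<k}"
    have "(\<Sum>g | g \<in> G \<and> inj_on g {0..<k} \<and> g ` {0..<k} = I. D g * (\<Prod>l<k. B (g l) l)) =
       (\<Sum>q | q permutes {0..<k}. D (?h q) * (\<Prod>l<k. B (?h q l) l))"
    proof (rule sum.reindex_cong[of ?h])
      show "inj_on ?h {q. q permutes {0..<k}}"
      proof (rule inj_onI, rule ext)
        fix q q' l assume q: "q \<in> {q. q permutes {0..<k}}" "q' \<in> {q. q permutes {0..<k}}" "?h q = ?h q'"
        show "q l = q' l"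
        proof (cases "l < k")
          case True
          then have "pick I (q l) = pick I (q' l)" using fun_cong[OF q(3), of l] by simp
          moreover have "q l \<in> {0..<k}" "q' l \<in> {0..<k}"
            using q True permutes_in_image by fastforce+
          ultimately show ?thesis using bp by (auto simp: bij_betw_def inj_on_def)
        next
          case False
          then show ?thesis using q by (auto simp: permutes_def)
        qed
      qed
      show "{g \<in> G. inj_on g {0..<k} \<and> g ` {0..<k} = I} = ?h ` {q. q permutes {0..<k}}"
      proof (intro equalityI subsetI)
        fix g assume g: "g \<in> {g \<in> G. inj_on g {0..<k} \<and> g ` {0..<k} = I}"
        then obtain q where q: "q permutes {0..<k}" "\<And>l. l < k \<Longrightarrow> g l = pick I (q l)"
          using inj_on_factor_pick[of g k I] by blast
        have "g = ?h q"
          by (rule ext) (use g q in \<open>auto simp: G_def PiE_def extensional_def\<close>)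
        then show "g \<in> ?h ` {q. q permutes {0..<k}}" using q by blast
      next
        fix g assume "g \<in> ?h ` {q. q permutes {0..<k}}"
        then obtain q where q: "q permutes {0..<k}" "g = ?h q" by blast
        have "bij_betw (pick I \<circ> q) {0..<k} I"
          using bij_betw_trans[OF permutes_imp_bij[OF q(1)] bp] .
        then have bg: "bij_betw g {0..<k} I"
          by (rule bij_betw_cong[THEN iffD1, rotated]) (simp add: q(2))
        moreover have "g \<in> G"
          using bij_betw_imp_surj_on[OF bg] I(1) by (auto simp: G_def q(2))
        ultimately show "g \<in> {g \<in> G. inj_on g {0..<k} \<and> g ` {0..<k} = I}"
          by (simp add: bij_betw_def)
      qed
    qed simp
    also have "\<dots> = (\<Sum>q | q permutes {0..<k}. det (mat k k (\<lambda>(a, c). A a (pick I c))) *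
        (signof q * (\<Prod>l<k. B (pick I (q l)) l)))"
    proof (rule sum.cong[OF refl])
      fix q assume "q \<in> {q. q permutes {0..<k}}"
      then have q: "q permutes {0..<k}" by simp
      let ?M = "mat k k (\<lambda>(a, c). A a (pick I c))"
      have ql: "q l < k" if "l < k" for l using permutes_in_image[OF q, of l] that by simp
      \<comment> \<open>Here \<open>q\<close> permutes columns, so the rule for permuted rows is
        applied to the transpose.\<close>
      have "D (?h q) = det (transpose_mat (mat k k (\<lambda>(i, j). transpose_mat ?M $$ (q i, j))))"
        unfolding D_def by (rule arg_cong[of _ _ det]) (auto simp: ql)
      also have "\<dots> = signof q * det ?M"
        by (subst det_transpose[of _ k], simp, subst det_permute_rows[OF _ q], simp)
          (simp add: det_transpose[of _ k])
      finally show "D (?h q) * (\<Prod>l<k. B (?h q l) l) =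
          det ?M * (signof q * (\<Prod>l<k. B (pick I (q l)) l))"
        by (simp add: mult_ac)
    qed
    also have "\<dots> = det (mat k k (\<lambda>(a, c). A a (pick I c))) *
       det (mat k k (\<lambda>(c, l). B (pick I c) l))"
      unfolding det_col_fun[of k "\<lambda>c l. B (pick I c) l"] by (simp add: sum_distrib_left)
    finally show "(\<Sum>g | g \<in> G \<and> inj_on g {0..<k} \<and> g ` {0..<k} = I. D g * (\<Prod>l<k. B (g l) l)) =
      det (mat k k (\<lambda>(a, c). A a (pick I c))) * det (mat k k (\<lambda>(c, l). B (pick I c) l))" .
  qed
  finally show ?thesis .
qed

text \<open>Each of the \<open>fact k\<close> terms of the Leibniz formula takes exactly one entry
  from every row and every column, hence has the same bound.\<close>

lemma abs_det_le:
  fixes M :: "nat \<Rightarrow> nat \<Rightarrow> real"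
  assumes "\<And>a l. a < k \<Longrightarrow> l < k \<Longrightarrow> \<bar>M a l\<bar> \<le> u a * v l"
  shows "\<bar>det (mat k k (\<lambda>(a, l). M a l))\<bar> \<le> fact k * (\<Prod>a<k. u a) * (\<Prod>l<k. v l)"
proof -
  have "\<bar>det (mat k k (\<lambda>(a, l). M a l))\<bar> \<le>
      (\<Sum>p | p permutes {0..<k}. \<bar>signof p * (\<Prod>l<k. M (p l) l)\<bar>)"
    unfolding det_col_fun by (rule sum_abs)
  also have "\<dots> \<le> (\<Sum>p | p permutes {0..<k}. (\<Prod>a<k. u a) * (\<Prod>l<k. v l))"
  proof (rule sum_mono)
    fix p assume "p \<in> {p. p permutes {0..<k}}"
    then have p: "p permutes {..<k}" by (simp add: atLeast0LessThan)
    have pl: "p l < k" if "l < k" for l using permutes_in_image[OF p, of l] that by simp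
    have "\<bar>signof p * (\<Prod>l<k. M (p l) l)\<bar> = (\<Prod>l<k. \<bar>M (p l) l\<bar>)"
      by (simp add: abs_mult abs_prod sign_def)
    also have "\<dots> \<le> (\<Prod>l<k. u (p l) * v l)" by (rule prod_mono) (use assms pl in auto)
    also have "\<dots> = (\<Prod>l<k. u (p l)) * (\<Prod>l<k. v l)" by (rule prod.distrib)
    also have "(\<Prod>l<k. u (p l)) = (\<Prod>a<k. u a)" using prod.permute[OF p, of u] by (simp add: o_def)
    finally show "\<bar>signof p * (\<Prod>l<k. M (p l) l)\<bar> \<le> (\<Prod>a<k. u a) * (\<Prod>l<k. v l)" .
  qed
  also have "\<dots> = fact k * (\<Prod>a<k. u a) * (\<Prod>l<k. v l)"
    by (simp add: card_permutations)
  finally show ?thesis .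
qed

lemma prod_pick: "finite I \<Longrightarrow> (\<Prod>a<card I. f (pick I a)) = (\<Prod>i\<in>I. f i)"
  using prod.reindex_bij_betw[OF bij_betw_pick, of I f] by (simp add: atLeast0LessThan)

section \<open>Points of compound boxes\<close>

text \<open>Extension by zero connects lattice vectors with the functions used for reduced bases and
  for Cauchy--Binet.\<close>

definition fvec :: "nat \<Rightarrow> real vec \<Rightarrow> nat \<Rightarrow> real" where
  "fvec d v j = (if j < d then v $ j else 0)"

lemma wedge_eq_det:
  assumes "I \<in> index_sets d (length zs)"
  shows "wedge d zs I =
    det (mat (length zs) (length zs) (\<lambda>(a, l). fvec d (zs ! l) (pick I a)))"
proof -
  have I: "I \<subseteq> {..<d}" "card I = length zs" using assms by (auto simp: index_sets_def)
  have eq: "{i. i < d \<and> i \<in> I} = I" using I(1) by auto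
  have "pick I a < d" if "a < length zs" for a
    using pick_in_set_le[of a I] that I by auto
  then have "submatrix (mat_of_cols d zs) I UNIV =
      mat (length zs) (length zs) (\<lambda>(a, l). fvec d (zs ! l) (pick I a))"
    by (intro eq_matI) (auto simp: submatrix_def eq I(2) pick_UNIV mat_of_cols_index fvec_def)
  then show ?thesis using I by (simp add: wedge_def)
qed

lemma wedge_outside: "I \<notin> index_sets d (length zs) \<Longrightarrow> wedge d zs I = 0"
  by (auto simp: wedge_def index_sets_def)

lemma wedge_in_exterior_lattice:
  "length zs = k \<Longrightarrow> set zs \<subseteq> L \<Longrightarrow> wedge d zs \<in> exterior_lattice d k L"
  unfolding exterior_lattice_def by (rule group_closure.base) blast

section \<open>Integral coordinates of points of the exterior lattice\<close>

lemma det_Ints: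
  fixes M :: "nat \<Rightarrow> nat \<Rightarrow> real"
  assumes "\<And>a l. a < k \<Longrightarrow> l < k \<Longrightarrow> M a l \<in> \<int>"
  shows "det (mat k k (\<lambda>(a, l). M a l)) \<in> \<int>"
  unfolding det_col_fun
proof (intro Ints_sum Ints_mult Ints_prod)
  fix p l assume "p \<in> {p. p permutes {0..<k}}" "l \<in> {..<k}"
  then show "M (p l) l \<in> \<int>" using permutes_in_image[of p "{0..<k}" l] by (intro assms) auto
qed simp

text \<open>This is the wedge product of the functionals \<open>F j\<close>,
  \<open>j \<in> J\<close>, evaluated at \<open>Z\<close>. If \<open>F\<close> is dual to a basis
  \<open>b\<close>, it reads off the coefficient of \<open>Z\<close> at the wedge product of the
  \<open>b j\<close>, \<open>j \<in> J\<close>.\<close>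

definition lattice_coord :: "nat \<Rightarrow> nat \<Rightarrow> (nat \<Rightarrow> nat \<Rightarrow> real) \<Rightarrow> nat set \<Rightarrow> (nat set \<Rightarrow> real) \<Rightarrow> real" where
  "lattice_coord d k F J Z =
    (\<Sum>I\<in>index_sets d k. det (mat k k (\<lambda>(a, c). F (pick J a) (pick I c))) * Z I)"

text \<open>Cauchy--Binet turns the sum over minors into the determinant of the pairings of
  functionals with vectors.\<close>

lemma lattice_coord_wedge:
  "lattice_coord d (length zs) F J (wedge d zs) =
    det (mat (length zs) (length zs) (\<lambda>(a, l). \<Sum>j<d. F (pick J a) j * fvec d (zs ! l) j))"
  unfolding lattice_coord_def cauchy_binet
  by (intro sum.cong refl) (simp add: wedge_eq_det)

lemma lattice_coord_diff:
  "lattice_coord d k F J (\<lambda>I. Z I - W I) = lattice_coord d k F J Z - lattice_coord d k F J W"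
  by (simp add: lattice_coord_def algebra_simps sum_subtractf)

lemma index_setsD: "I \<in> index_sets d k \<Longrightarrow> I \<subseteq> {..<d} \<and> card I = k \<and> finite I"
  by (auto simp: index_sets_def intro: finite_subset)

text \<open>On a wedge of lattice vectors, the coordinates are determinants of integers, and the
  expansion is Cauchy--Binet for the matrix of the vectors factored through their coordinates. Both
  properties are preserved by differences, so they pass to the generated group.\<close>

lemma exterior_lattice_coords:
  assumes int: "\<And>x i. x \<in> L \<Longrightarrow> i < p \<Longrightarrow> (\<Sum>j<d. F i j * fvec d x j) \<in> \<int>"
    and exp: "\<And>x j. x \<in> L \<Longrightarrow> j < d \<Longrightarrow>
      fvec d x j = (\<Sum>i<p. (\<Sum>j<d. F i j * fvec d x j) * b i j)"
    and Z: "Z \<in> exterior_lattice d k L"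
  shows "(\<forall>J\<in>index_sets p k. lattice_coord d k F J Z \<in> \<int>) \<and>
    (\<forall>I\<in>index_sets d k. Z I = (\<Sum>J\<in>index_sets p k. lattice_coord d k F J Z *
       det (mat k k (\<lambda>(a, c). b (pick J c) (pick I a)))))"
  using Z unfolding exterior_lattice_def
proof (induction rule: group_closure.induct)
  case (base Z)
  \<comment> \<open>The base case of \<open>group_closure\<close> covers 0 in addition to the
    generators.\<close>
  show ?case
  proof (cases "Z = 0")
    case True
    then show ?thesis by (simp add: lattice_coord_def)
  next
    case False
    then obtain zs where zs: "length zs = k" "set zs \<subseteq> L" "Z = wedge d zs" using base by auto
    have zL: "zs ! l \<in> L" if "l < k" for l using zs that by auto
    have coord: "lattice_coord d k F J Z =
      det (mat k k (\<lambda>(a, l). \<Sum>j<d. F (pick J a) j * fvec d (zs ! l) j))" for J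
      using lattice_coord_wedge[of d zs F J] zs by simp
    show ?thesis
    proof (intro conjI ballI)
      fix J assume J: "J \<in> index_sets p k"
      have "pick J a < p" if "a < k" for a using pick_in_set_le[of a J] index_setsD[OF J] that by auto
      then show "lattice_coord d k F J Z \<in> \<int>"
        unfolding coord by (intro det_Ints int zL)
    next
      fix I assume I: "I \<in> index_sets d k"
      have pI: "pick I a < d" if "a < k" for a
        using pick_in_set_le[of a I] index_setsD[OF I] that by auto
      have "Z I = det (mat k k (\<lambda>(a, l). fvec d (zs ! l) (pick I a)))"
        using wedge_eq_det[of I d zs] I zs by simp
      also have "mat k k (\<lambda>(a, l). fvec d (zs ! l) (pick I a)) =
          mat k k (\<lambda>(a, l). \<Sum>i<p. b i (pick I a) * (\<Sum>j<d. F i j * fvec d (zs ! l) j))"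
      proof (rule eq_matI)
        fix a l assume "a < dim_row (mat k k (\<lambda>(a, l). \<Sum>i<p. b i (pick I a) * (\<Sum>j<d. F i j * fvec d (zs ! l) j)))"
          "l < dim_col (mat k k (\<lambda>(a, l). \<Sum>i<p. b i (pick I a) * (\<Sum>j<d. F i j * fvec d (zs ! l) j)))"
        then show "mat k k (\<lambda>(a, l). fvec d (zs ! l) (pick I a)) $$ (a, l) =
           mat k k (\<lambda>(a, l). \<Sum>i<p. b i (pick I a) * (\<Sum>j<d. F i j * fvec d (zs ! l) j)) $$ (a, l)"
          using exp[OF zL pI, of l a] by (simp add: mult.commute)
      qed simp_all
      also have "det \<dots> = (\<Sum>J\<in>index_sets p k. det (mat k k (\<lambda>(a, c). b (pick J c) (pick I a))) *
          lattice_coord d k F J Z)"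
        unfolding cauchy_binet[of k "\<lambda>a i. b i (pick I a)"] coord ..
      finally show "Z I = (\<Sum>J\<in>index_sets p k. lattice_coord d k F J Z *
         det (mat k k (\<lambda>(a, c). b (pick J c) (pick I a))))" by (simp add: mult.commute)
    qed
  qed
next
  case (diff Z W)
  show ?case
    using diff.IH
    by (auto simp: lattice_coord_diff left_diff_distrib sum_subtractf fun_diff_def intro: Ints_diff)
qed

text \<open>If the largest factor is at least 1, removing it does not increase the product;
  otherwise all factors are below 1, and what remains is at most 1, hence at most
  \<open>B\<close>.\<close>

lemma prod_remove_max_le:
  fixes r :: "nat \<Rightarrow> real"
  assumes "finite J" "J \<noteq> {}" "\<And>i. i \<in> J \<Longrightarrow> r i > 0" "(\<Prod>i\<in>J. r i) \<le> B" "B \<ge> 1"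
  obtains i where "i \<in> J" "(\<Prod>i\<in>J - {i}. r i) \<le> B"
proof -
  obtain i where i: "i \<in> J" "\<And>l. l \<in> J \<Longrightarrow> r l \<le> r i"
    using finite_imageI[OF assms(1), of r] assms(2) Max_in[of "r ` J"] Max_ge[of "r ` J"] by fastforce
  have pos: "(\<Prod>l\<in>J - {i}. r l) > 0" using assms(3) by (intro prod_pos) auto
  have eq: "(\<Prod>l\<in>J. r l) = r i * (\<Prod>l\<in>J - {i}. r l)"
    using i(1) assms(1) by (simp add: prod.remove)
  have "(\<Prod>l\<in>J - {i}. r l) \<le> B"
  proof (cases "r i \<ge> 1")
    case True
    then have "1 * (\<Prod>l\<in>J - {i}. r l) \<le> r i * (\<Prod>l\<in>J - {i}. r l)"
      using pos by (intro mult_right_mono) auto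
    then show ?thesis using eq assms(4) by simp
  next
    case False
    have "(\<Prod>l\<in>J - {i}. r l) \<le> 1"
      using False i(2) assms(3) by (intro prod_le_1) force+
    then show ?thesis using assms(5) by simp
  qed
  then show ?thesis using that i(1) by blast
qed

section \<open>Descent by one degree in compound boxes\<close>

definition discrete_lattice :: "nat \<Rightarrow> real vec set \<Rightarrow> bool" where
  "discrete_lattice d L \<longleftrightarrow> L \<subseteq> carrier_vec d \<and> 0\<^sub>v d \<in> L \<and> (\<forall>x\<in>L. \<forall>y\<in>L. x - y \<in> L) \<and>
    (\<forall>R. finite {x \<in> L. \<forall>j<d. \<bar>x $ j\<bar> \<le> R})"

text \<open>
  Mahler's theorem on compound bodies says that the first minimum of \<open>\<P>\<^sup>[\<^sup>k\<^sup>]\<close> is comparable to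
  \<open>\<lambda>\<^sub>1 \<dots> \<lambda>\<^sub>k\<close>. Here \<open>r\<close> plays the role of the successive minima, and dropping the largest
  factor of a product that is at most 1 keeps it at most 1.
\<close>

lemma compound_box_descent:
  "\<exists>C\<ge>1. \<forall>L c Z. discrete_lattice d L \<longrightarrow> (\<forall>i<d. c i > 0) \<longrightarrow>
     Z \<in> exterior_lattice d (Suc k) L \<longrightarrow> Z \<noteq> 0 \<longrightarrow> Z \<in> compound_box d (Suc k) c \<longrightarrow>
     (\<exists>W\<in>exterior_lattice d k L. W \<noteq> 0 \<and> W \<in> exterior_power d k \<and>
        (\<forall>I\<in>index_sets d k. \<bar>W I\<bar> \<le> C * (\<Prod>i\<in>I. c i)))"
proof -
  obtain C where C: "C \<ge> 1" and red: "\<forall>S L. finite S \<longrightarrow> card S = d \<longrightarrow> discrete_subgroup S L \<longrightarrow>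
     (\<exists>p b F r. reduced_basis S C L p b F r)"
    using reduced_basis_exists[of d] by (elim exE conjE)
  \<comment> \<open>\<open>B - 1\<close> bounds the product of the weights over \<open>J\<close>:
    there is one term for each coordinate of \<open>Z\<close>, each a determinant bounded by
    \<open>abs_det_le\<close>. The added 1 gives \<open>B \<ge> 1\<close>, which
    \<open>prod_remove_max_le\<close> needs.\<close>
  define B where "B = 1 + real (card (index_sets d (Suc k))) * (fact (Suc k) * C ^ Suc k)"
  have B: "B \<ge> 1" using C by (simp add: B_def)
  define C2 where "C2 = fact k * C ^ k * B"
  have "1 * 1 * 1 \<le> C2" unfolding C2_def using C B by (intro mult_mono) (auto simp: one_le_power)
  then have C2: "C2 \<ge> 1" by simp
  show ?thesis
  proof (intro exI[of _ C2] conjI allI impI C2)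
    fix L :: "real vec set" and c Z
    assume L: "discrete_lattice d L" and c: "\<forall>i<d. c i > 0"
      and Z: "Z \<in> exterior_lattice d (Suc k) L" "Z \<noteq> 0" "Z \<in> compound_box d (Suc k) c"
    have c0: "c j \<noteq> 0" if "j < d" for j using c that by (metis less_irrefl)
    \<comment> \<open>Rescaling turns the box into the unit cube, so that one constant serves all
      boxes.\<close>
    define scale where "scale x j = fvec d x j / c j" for x j
    define S where "S = {..<d}"
    have "discrete_subgroup S (scale ` L)"
      unfolding discrete_subgroup_def
    proof (intro conjI allI ballI impI)
      show "0 \<in> scale ` L"
        by (rule image_eqI[of _ _ "0\<^sub>v d"]) (use L in \<open>auto simp: discrete_lattice_def scale_def fvec_def\<close>)
      fix x y assume "x \<in> scale ` L" "y \<in> scale ` L"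
      then obtain u v where uv: "u \<in> L" "v \<in> L" "x = scale u" "y = scale v" by auto
      have "u - v \<in> L" "u \<in> carrier_vec d" "v \<in> carrier_vec d" using uv L by (auto simp: discrete_lattice_def)
      moreover from this have "x - y = scale (u - v)"
        unfolding uv by (auto simp: scale_def fvec_def diff_divide_distrib)
      ultimately show "x - y \<in> scale ` L" by simp
    next
      fix x j assume "x \<in> scale ` L" "j \<notin> S"
      then show "x j = 0" by (auto simp: scale_def fvec_def S_def)
    next
      fix R
      define M where "M = (\<Sum>j<d. \<bar>R\<bar> * c j)"
      have "{x \<in> scale ` L. \<forall>j\<in>S. \<bar>x j\<bar> \<le> R} \<subseteq> scale ` {x \<in> L. \<forall>j<d. \<bar>x $ j\<bar> \<le> M}"
      proof
        fix x assume "x \<in> {x \<in> scale ` L. \<forall>j\<in>S. \<bar>x j\<bar> \<le> R}"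
        then obtain u where u: "u \<in> L" "x = scale u" "\<forall>j\<in>S. \<bar>x j\<bar> \<le> R" by auto
        have "\<bar>u $ j\<bar> \<le> M" if "j < d" for j
        proof -
          have cj: "c j > 0" using c that by simp
          have "\<bar>u $ j / c j\<bar> \<le> R" using u(3) that by (simp add: S_def u(2) scale_def fvec_def)
          then have "\<bar>u $ j / c j\<bar> \<le> \<bar>R\<bar>" by linarith
          then have "\<bar>u $ j\<bar> \<le> \<bar>R\<bar> * c j" using cj by (simp add: abs_divide field_simps)
          also have "\<dots> \<le> M" unfolding M_def
            using that c by (intro member_le_sum) (auto simp: less_imp_le)
          finally show ?thesis .
        qed
        then show "x \<in> scale ` {x \<in> L. \<forall>j<d. \<bar>x $ j\<bar> \<le> M}" using u by blast
      qed
      moreover have "finite {x \<in> L. \<forall>j<d. \<bar>x $ j\<bar> \<le> M}" using L by (simp add: discrete_lattice_def)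
      ultimately show "finite {x \<in> scale ` L. \<forall>j\<in>S. \<bar>x j\<bar> \<le> R}"
        using finite_surj by blast
    qed
    moreover have "finite S" "card S = d" by (auto simp: S_def)
    ultimately obtain p b0 F0 r where rb: "reduced_basis S C (scale ` L) p b0 F0 r"
      using red by blast
    \<comment> \<open>The functionals on the rescaled lattice, expressed in the original
      coordinates.\<close>
    define F where "F i j = F0 i j / c j" for i j
    have F_scale: "(\<Sum>j\<in>S. F0 i j * scale x j) = (\<Sum>j<d. F i j * fvec d x j)" for i x
      by (auto simp: S_def F_def scale_def)
    have b0L: "b0 i \<in> scale ` L" and r: "r i > 0" and b0_le: "j < d \<Longrightarrow> \<bar>b0 i j\<bar> \<le> C * r i"
        and F0_le: "j < d \<Longrightarrow> \<bar>F0 i j\<bar> \<le> C / r i" if "i < p" for i j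
        using rb that by (auto simp: reduced_basis_def S_def)
    have "\<forall>i. \<exists>x. i < p \<longrightarrow> x \<in> L \<and> b0 i = scale x" using b0L by blast
    then obtain v where v: "\<And>i. i < p \<Longrightarrow> v i \<in> L" "\<And>i. i < p \<Longrightarrow> b0 i = scale (v i)" by metis
    define b where "b i = fvec d (v i)" for i
    have b_eq: "b i j = b0 i j * c j" if "i < p" "j < d" for i j
      using that c0 by (simp add: b_def v(2) scale_def)
    have dual: "(\<Sum>j<d. F i j * b l j) = (if i = l then 1 else 0)" if "i < p" "l < p" for i l
    proof -
      have "(\<Sum>j\<in>S. F0 i j * b0 l j) = (if i = l then 1 else 0)"
        using rb that unfolding reduced_basis_def by blast
      then show ?thesis using F_scale[of i "v l"] v(2)[OF that(2)] by (simp add: b_def)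
    qed
    have int: "(\<Sum>j<d. F i j * fvec d x j) \<in> \<int>" if "x \<in> L" "i < p" for x i
    proof -
      have "scale x \<in> scale ` L" using that by simp
      then have "(\<Sum>j\<in>S. F0 i j * scale x j) \<in> \<int>"
        using rb that(2) unfolding reduced_basis_def by blast
      then show ?thesis by (simp only: F_scale)
    qed
    have exp: "fvec d x j = (\<Sum>i<p. (\<Sum>j<d. F i j * fvec d x j) * b i j)" if "x \<in> L" "j < d" for x j
    proof -
      have "scale x \<in> scale ` L" "j \<in> S" using that by (simp_all add: S_def)
      then have "scale x j = (\<Sum>i<p. (\<Sum>j\<in>S. F0 i j * scale x j) * b0 i j)"
        using rb unfolding reduced_basis_def by blast
      then have "fvec d x j / c j * c j = (\<Sum>i<p. (\<Sum>j<d. F i j * fvec d x j) * b0 i j) * c j"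
        unfolding F_scale by (simp add: scale_def)
      moreover have "fvec d x j / c j * c j = fvec d x j" using c0 that by simp
      ultimately show ?thesis using that(2) by (simp add: sum_distrib_right b_eq mult.assoc)
    qed
    note coords = exterior_lattice_coords[OF int exp Z(1)]
    have "\<exists>J\<in>index_sets p (Suc k). lattice_coord d (Suc k) F J Z \<noteq> 0"
    proof (rule ccontr)
      assume "\<not> ?thesis"
      then have "Z I = 0" if "I \<in> index_sets d (Suc k)" for I using coords that by simp
      moreover have "Z I = 0" if "I \<notin> index_sets d (Suc k)" for I
        using Z(3) that unfolding compound_box_def exterior_power_def index_sets_def by blast
      ultimately show False using Z(2) by (auto simp: fun_eq_iff)
    qed
    then obtain J where J: "J \<in> index_sets p (Suc k)" "lattice_coord d (Suc k) F J Z \<noteq> 0" by blast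
    have J': "J \<subseteq> {..<p}" "card J = Suc k" "finite J" using index_setsD[OF J(1)] by auto
    have pJ: "pick J a < p" if "a < Suc k" for a using pick_in_set_le[of a J] J' that by auto
    have prJ: "(\<Prod>i\<in>J. r i) > 0" using J'(1) r by (intro prod_pos) auto
    \<comment> \<open>The arithmetic input: a nonzero integer has absolute value at least 1. In the
      upper bound the sides of the box cancel, leaving only the weights \<open>r\<close>.\<close>
    have "1 \<le> \<bar>lattice_coord d (Suc k) F J Z\<bar>"
      using coords J Ints_nonzero_abs_ge1 by blast
    also have "\<dots> \<le> (\<Sum>I\<in>index_sets d (Suc k).
        \<bar>det (mat (Suc k) (Suc k) (\<lambda>(a, c). F (pick J a) (pick I c))) * Z I\<bar>)"
      unfolding lattice_coord_def by (rule sum_abs)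
    also have "\<dots> \<le> (\<Sum>I\<in>index_sets d (Suc k). fact (Suc k) * C ^ Suc k / (\<Prod>i\<in>J. r i))"
    proof (rule sum_mono)
      fix I assume I: "I \<in> index_sets d (Suc k)"
      note I' = index_setsD[OF I]
      have pI: "pick I a < d" if "a < Suc k" for a using pick_in_set_le[of a I] I' that by auto
      have cI: "(\<Prod>i\<in>I. c i) > 0" using I' c by (intro prod_pos) auto
      have "\<bar>det (mat (Suc k) (Suc k) (\<lambda>(a, l). F (pick J a) (pick I l)))\<bar> \<le>
         fact (Suc k) * (\<Prod>a<Suc k. C / r (pick J a)) * (\<Prod>l<Suc k. 1 / c (pick I l))"
      proof (rule abs_det_le)
        fix a l assume al: "a < Suc k" "l < Suc k"
        have "\<bar>F0 (pick J a) (pick I l)\<bar> / c (pick I l) \<le> C / r (pick J a) / c (pick I l)"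
          using c pI[OF al(2)] F0_le[OF pJ[OF al(1)] pI[OF al(2)]] by (intro divide_right_mono) auto
        then show "\<bar>F (pick J a) (pick I l)\<bar> \<le> C / r (pick J a) * (1 / c (pick I l))"
          using c[rule_format, OF pI[OF al(2)]] by (simp add: F_def abs_divide)
      qed
      also have "(\<Prod>a<Suc k. C / r (pick J a)) = C ^ Suc k / (\<Prod>i\<in>J. r i)"
        using prod_pick[OF J'(3), of "\<lambda>i. C / r i"] J'(2) by (simp add: prod_dividef)
      also have "(\<Prod>l<Suc k. 1 / c (pick I l)) = 1 / (\<Prod>i\<in>I. c i)"
        using prod_pick[of I "\<lambda>i. 1 / c i"] I' by (simp add: prod_dividef)
      finally have "\<bar>det (mat (Suc k) (Suc k) (\<lambda>(a, l). F (pick J a) (pick I l)))\<bar> * \<bar>Z I\<bar> \<le>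
         fact (Suc k) * (C ^ Suc k / (\<Prod>i\<in>J. r i)) * (1 / (\<Prod>i\<in>I. c i)) * (\<Prod>i\<in>I. c i)"
      proof (rule mult_mono)
        show "\<bar>Z I\<bar> \<le> (\<Prod>i\<in>I. c i)" using Z(3) I' by (simp add: compound_box_def)
      qed (use C prJ cI in auto)
      then show "\<bar>det (mat (Suc k) (Suc k) (\<lambda>(a, c). F (pick J a) (pick I c))) * Z I\<bar> \<le>
          fact (Suc k) * C ^ Suc k / (\<Prod>i\<in>J. r i)"
        using cI by (simp add: abs_mult del: fact_Suc power_Suc)
    qed
    also have "\<dots> = (B - 1) / (\<Prod>i\<in>J. r i)" by (simp add: B_def)
    finally have J_le: "(\<Prod>i\<in>J. r i) \<le> B" using prJ by (simp add: field_simps)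
    have "J \<noteq> {}" "\<And>i. i \<in> J \<Longrightarrow> r i > 0" using J' r by auto
    then obtain i0 where i0: "i0 \<in> J" "(\<Prod>i\<in>J - {i0}. r i) \<le> B"
      using prod_remove_max_le[OF J'(3) _ _ J_le B] by blast
    \<comment> \<open>The point sought is the wedge of the basis vectors with indices in
      \<open>K\<close>; its coordinates are controlled by the product of \<open>r\<close> over
      \<open>K\<close>, which is at most \<open>B\<close>.\<close>
    define K where "K = J - {i0}"
    have K: "K \<subseteq> {..<p}" "card K = k" "finite K" using J' i0 by (auto simp: K_def)
    have pK: "pick K a < p" if "a < k" for a using pick_in_set_le[of a K] K that by auto
    define zs where "zs = map (\<lambda>a. v (pick K a)) [0..<k]"
    have zs: "length zs = k" "\<And>l. l < k \<Longrightarrow> fvec d (zs ! l) = b (pick K l)"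
      by (simp_all add: zs_def b_def)
    define W where "W = wedge d zs"
    have W_in: "W \<in> exterior_lattice d k L"
      unfolding W_def by (rule wedge_in_exterior_lattice[OF zs(1)]) (auto simp: zs_def v(1) pK)
    have W_pow: "W \<in> exterior_power d k"
      using wedge_outside[of _ d zs] zs(1) by (auto simp: exterior_power_def W_def index_sets_def)
    \<comment> \<open>By duality the coordinate of \<open>W\<close> at \<open>K\<close> is the
      determinant of the identity, which shows \<open>W \<noteq> 0\<close>.\<close>
    have "lattice_coord d k F K W = det (mat k k (\<lambda>(a, l). \<Sum>j<d. F (pick K a) j * fvec d (zs ! l) j))"
      using lattice_coord_wedge[of d zs F K] zs(1) by (simp add: W_def)
    also have "mat k k (\<lambda>(a, l). \<Sum>j<d. F (pick K a) j * fvec d (zs ! l) j) = 1\<^sub>m k"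
    proof (rule eq_matI)
      fix a l assume "a < dim_row (1\<^sub>m k :: real mat)" "l < dim_col (1\<^sub>m k :: real mat)"
      moreover from this have "pick K a = pick K l \<longleftrightarrow> a = l"
        using bij_betw_pick[OF K(3)] K(2) by (auto simp: bij_betw_def inj_on_def)
      ultimately show "mat k k (\<lambda>(a, l). \<Sum>j<d. F (pick K a) j * fvec d (zs ! l) j) $$ (a, l) = 1\<^sub>m k $$ (a, l)"
        by (simp add: zs(2) dual pK)
    qed simp_all
    finally have "lattice_coord d k F K W = 1" by simp
    then have W0: "W \<noteq> 0" by (auto simp: lattice_coord_def)
    have "\<bar>W I\<bar> \<le> C2 * (\<Prod>i\<in>I. c i)" if I: "I \<in> index_sets d k" for I
    proof -
      note I' = index_setsD[OF I]
      have pI: "pick I a < d" if "a < k" for a using pick_in_set_le[of a I] I' that by auto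
      have cI: "(\<Prod>i\<in>I. c i) > 0" using I' c by (intro prod_pos) auto
      have "W I = det (mat k k (\<lambda>(a, l). fvec d (zs ! l) (pick I a)))"
        using wedge_eq_det[of I d zs] I zs(1) by (simp add: W_def)
      also have "\<bar>\<dots>\<bar> \<le> fact k * (\<Prod>a<k. c (pick I a)) * (\<Prod>l<k. C * r (pick K l))"
      proof (rule abs_det_le)
        fix a l assume al: "a < k" "l < k"
        have "\<bar>b0 (pick K l) (pick I a)\<bar> * c (pick I a) \<le> C * r (pick K l) * c (pick I a)"
          using c pI[OF al(1)] b0_le[OF pK[OF al(2)] pI[OF al(1)]] by (intro mult_right_mono) auto
        then show "\<bar>fvec d (zs ! l) (pick I a)\<bar> \<le> c (pick I a) * (C * r (pick K l))"
          using c[rule_format, OF pI[OF al(1)]] pI[OF al(1)] al pK[OF al(2)]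
          by (simp add: zs(2) b_eq abs_mult mult_ac)
      qed
      also have "(\<Prod>a<k. c (pick I a)) = (\<Prod>i\<in>I. c i)" using prod_pick[of I c] I' by simp
      also have "(\<Prod>l<k. C * r (pick K l)) = C ^ k * (\<Prod>i\<in>K. r i)"
        using prod_pick[OF K(3), of "\<lambda>i. C * r i"] K(2) by (simp add: prod.distrib)
      also have "fact k * (\<Prod>i\<in>I. c i) * (C ^ k * (\<Prod>i\<in>K. r i)) \<le> fact k * (\<Prod>i\<in>I. c i) * (C ^ k * B)"
        using i0(2) cI C by (intro mult_left_mono) (auto simp: K_def)
      finally show ?thesis by (simp add: C2_def mult_ac)
    qed
    then show "\<exists>W\<in>exterior_lattice d k L. W \<noteq> 0 \<and> W \<in> exterior_power d k \<and>
        (\<forall>I\<in>index_sets d k. \<bar>W I\<bar> \<le> C2 * (\<Prod>i\<in>I. c i))"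
      using W_in W_pow W0 by blast
  qed
qed

section \<open>Monotonicity of the exponents\<close>

lemma sum_lessThan_add:
  fixes f :: "nat \<Rightarrow> 'a :: comm_monoid_add"
  shows "(\<Sum>i<m + n. f i) = (\<Sum>i<m. f i) + (\<Sum>i<n. f (m + i))"
  by (induction n) (auto simp: add.assoc)

section \<open>The lattice \<Lambda>(\<Theta>) and its discreteness\<close>

definition theta_vec :: "real mat \<Rightarrow> (nat \<Rightarrow> int) \<Rightarrow> real vec" where
  "theta_vec \<Theta> z = vec (dim_col \<Theta> + dim_row \<Theta>) (\<lambda>i. if i < dim_col \<Theta> then of_int (z i)
     else of_int (z i) - (\<Sum>j<dim_col \<Theta>. \<Theta> $$ (i - dim_col \<Theta>, j) * of_int (z j)))"

lemma theta_lattice_eq: "theta_lattice \<Theta> = range (theta_vec \<Theta>)"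
proof -
  let ?m = "dim_col \<Theta>" and ?n = "dim_row \<Theta>"
  let ?A = "four_block_mat (1\<^sub>m ?m) (0\<^sub>m ?m ?n) (- \<Theta>) (1\<^sub>m ?n)"
  have eq: "?A *\<^sub>v map_vec of_int z = theta_vec \<Theta> (\<lambda>i. z $ i)" if z: "z \<in> carrier_vec (?m + ?n)" for z
  proof (rule eq_vecI)
    fix i assume "i < dim_vec (theta_vec \<Theta> (\<lambda>i. z $ i))"
    then have i: "i < ?m + ?n" by (simp add: theta_vec_def)
    have "(?A *\<^sub>v map_vec of_int z) $ i = (\<Sum>j<?m + ?n. ?A $$ (i, j) * of_int (z $ j))"
      using i z by (auto simp: scalar_prod_def atLeast0LessThan intro!: sum.cong)
    also have "\<dots> = (\<Sum>j<?m. ?A $$ (i, j) * of_int (z $ j)) +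
        (\<Sum>j<?n. ?A $$ (i, ?m + j) * of_int (z $ (?m + j)))"
      by (rule sum_lessThan_add)
    also have "\<dots> = theta_vec \<Theta> (\<lambda>i. z $ i) $ i"
    proof (cases "i < ?m")
      case True
      have "(\<Sum>j<?m. ?A $$ (i, j) * of_int (z $ j)) = (\<Sum>j<?m. if j = i then of_int (z $ j) else 0)"
        using True i by (intro sum.cong) auto
      then show ?thesis using True i by (simp add: theta_vec_def)
    next
      case False
      have "(\<Sum>j<?n. ?A $$ (i, ?m + j) * of_int (z $ (?m + j))) =
          (\<Sum>j<?n. if j = i - ?m then of_int (z $ (?m + j)) else 0)"
        using False i by (intro sum.cong) auto
      moreover have "(\<Sum>j<?m. ?A $$ (i, j) * of_int (z $ j)) =
          - (\<Sum>j<?m. \<Theta> $$ (i - ?m, j) * of_int (z $ j))"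
        unfolding sum_negf[symmetric] using False i by (intro sum.cong) auto
      ultimately show ?thesis using False i by (simp add: theta_vec_def)
    qed
    finally show "(?A *\<^sub>v map_vec of_int z) $ i = theta_vec \<Theta> (\<lambda>i. z $ i) $ i" .
  qed (simp add: theta_vec_def)
  show ?thesis
  proof (intro equalityI subsetI)
    fix x assume "x \<in> theta_lattice \<Theta>"
    then show "x \<in> range (theta_vec \<Theta>)" using eq by (auto simp: theta_lattice_def Let_def)
  next
    fix x assume "x \<in> range (theta_vec \<Theta>)"
    then obtain z where "x = theta_vec \<Theta> z" by auto
    also have "\<dots> = theta_vec \<Theta> (\<lambda>i. vec (?m + ?n) z $ i)"
      unfolding theta_vec_def by (intro eq_vecI) auto
    also have "\<dots> = ?A *\<^sub>v map_vec of_int (vec (?m + ?n) z)" by (rule eq[symmetric]) simp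
    finally show "x \<in> theta_lattice \<Theta>" unfolding theta_lattice_def Let_def by fastforce
  qed
qed

lemma theta_vec_index:
  assumes "\<Theta> \<in> carrier_mat n m"
  shows "j < m \<Longrightarrow> theta_vec \<Theta> z $ j = of_int (z j)"
    and "i < n \<Longrightarrow> theta_vec \<Theta> z $ (m + i) = of_int (z (m + i)) - (\<Sum>j<m. \<Theta> $$ (i, j) * of_int (z j))"
  using assms by (auto simp: theta_vec_def)

lemma theta_vec_carrier: "\<Theta> \<in> carrier_mat n m \<Longrightarrow> theta_vec \<Theta> z \<in> carrier_vec (m + n)"
  by (auto simp: theta_vec_def)

text \<open>In a bounded region the first \<open>m\<close> coordinates are themselves bounded
  integers. They bound the linear forms, and so the remaining integers, leaving finitely many
  choices.\<close>

lemma discrete_theta_lattice: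
  assumes \<Theta>: "\<Theta> \<in> carrier_mat n m"
  shows "discrete_lattice (m + n) (theta_lattice \<Theta>)"
  unfolding discrete_lattice_def theta_lattice_eq
proof (intro conjI allI ballI)
  show "range (theta_vec \<Theta>) \<subseteq> carrier_vec (m + n)" using theta_vec_carrier[OF \<Theta>] by auto
  show "0\<^sub>v (m + n) \<in> range (theta_vec \<Theta>)"
    by (rule range_eqI[of _ _ "\<lambda>_. 0"]) (use \<Theta> in \<open>auto simp: theta_vec_def\<close>)
  fix x y assume "x \<in> range (theta_vec \<Theta>)" "y \<in> range (theta_vec \<Theta>)"
  then obtain z w where zw: "x = theta_vec \<Theta> z" "y = theta_vec \<Theta> w" by auto
  show "x - y \<in> range (theta_vec \<Theta>)"
    unfolding zw by (rule range_eqI[of _ _ "\<lambda>i. z i - w i"])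
      (auto simp: theta_vec_def right_diff_distrib sum_subtractf)
next
  fix R :: real
  define N where "N = \<bar>R\<bar> + (\<Sum>i<n. \<Sum>j<m. \<bar>\<Theta> $$ (i, j)\<bar> * \<bar>R\<bar>)"
  define G where "G = {..<m + n} \<rightarrow>\<^sub>E {- \<lceil>N\<rceil>..\<lceil>N\<rceil>}"
  have T0: "(\<Sum>i<n. \<Sum>j<m. \<bar>\<Theta> $$ (i, j)\<bar> * \<bar>R\<bar>) \<ge> 0" by (intro sum_nonneg) auto
  have "{x \<in> range (theta_vec \<Theta>). \<forall>j<m + n. \<bar>x $ j\<bar> \<le> R} \<subseteq> theta_vec \<Theta> ` G"
  proof
    fix x assume "x \<in> {x \<in> range (theta_vec \<Theta>). \<forall>j<m + n. \<bar>x $ j\<bar> \<le> R}"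
    then obtain z where z: "x = theta_vec \<Theta> z" "\<forall>j<m + n. \<bar>x $ j\<bar> \<le> R" by auto
    have 1: "\<bar>of_int (z j)\<bar> \<le> \<bar>R\<bar>" if "j < m" for j
    proof -
      have "\<bar>x $ j\<bar> \<le> R" using z(2) that by simp
      then show ?thesis using theta_vec_index(1)[OF \<Theta> that, of z] z(1) by simp
    qed
    have 2: "\<bar>of_int (z i)\<bar> \<le> N" if i: "i < m + n" for i
    proof (cases "i < m")
      case True
      then show ?thesis using 1[OF True] T0 by (simp add: N_def)
    next
      case False
      then obtain l where l: "i = m + l" "l < n" using i by (metis add_diff_inverse_nat nat_add_left_cancel_less)
      have "\<bar>\<Sum>j<m. \<Theta> $$ (l, j) * of_int (z j)\<bar> \<le> (\<Sum>j<m. \<bar>\<Theta> $$ (l, j)\<bar> * \<bar>R\<bar>)"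
        by (rule order_trans[OF sum_abs sum_mono]) (auto simp: abs_mult intro!: mult_left_mono 1)
      also have "\<dots> \<le> (\<Sum>i<n. \<Sum>j<m. \<bar>\<Theta> $$ (i, j)\<bar> * \<bar>R\<bar>)"
        using l by (intro member_le_sum[where f = "\<lambda>i. \<Sum>j<m. \<bar>\<Theta> $$ (i, j)\<bar> * \<bar>R\<bar>"]) (auto intro: sum_nonneg)
      finally have "\<bar>\<Sum>j<m. \<Theta> $$ (l, j) * of_int (z j)\<bar> \<le> (\<Sum>i<n. \<Sum>j<m. \<bar>\<Theta> $$ (i, j)\<bar> * \<bar>R\<bar>)" .
      moreover have "\<bar>x $ i\<bar> \<le> R" using z(2) i by simp
      ultimately show ?thesis using theta_vec_index(2)[OF \<Theta> l(2), of z] unfolding N_def l(1) z(1) by linarith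
    qed
    have "z i \<in> {- \<lceil>N\<rceil>..\<lceil>N\<rceil>}" if "i < m + n" for i using 2[OF that] by (simp, linarith)
    then have "restrict z {..<m + n} \<in> G" by (simp add: G_def)
    moreover have "x = theta_vec \<Theta> (restrict z {..<m + n})"
      unfolding z(1) theta_vec_def using \<Theta> by (intro eq_vecI) auto
    ultimately show "x \<in> theta_vec \<Theta> ` G" by blast
  qed
  moreover have "finite G" by (simp add: G_def finite_PiE)
  ultimately show "finite {x \<in> range (theta_vec \<Theta>). \<forall>j<m + n. \<bar>x $ j\<bar> \<le> R}"
    by (rule finite_surj[rotated])
qed

section \<open>Admissible exponents and the loss of constant factors\<close>

definition exponents :: "nat \<Rightarrow> (nat \<Rightarrow> real) \<Rightarrow> (nat \<Rightarrow> real) \<Rightarrow> real mat \<Rightarrow> real set" where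
  "exponents k \<sigma> \<rho> \<Theta> = {\<gamma>. \<forall>S. \<exists>s>S. \<exists>Z \<in> exterior_lattice (dim_col \<Theta> + dim_row \<Theta>) k (theta_lattice \<Theta>).
     Z \<noteq> 0 \<and> Z \<in> compound_box (dim_col \<Theta> + dim_row \<Theta>) k (box_sides (dim_col \<Theta>) \<sigma> \<rho> s \<gamma>)}"

lemma Omega_eq_Sup: "Omega k \<sigma> \<rho> \<Theta> = Sup (ereal ` exponents k \<sigma> \<rho> \<Theta>)"
  unfolding Omega_def exponents_def Let_def by (rule arg_cong[of _ _ Sup]) auto

lemma box_sides_pos [simp]: "box_sides m \<sigma> \<rho> s \<gamma> i > 0"
  by (simp add: box_sides_def)

text \<open>A fixed shift \<open>h\<close> of the parameter enlarges the first \<open>m\<close>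
  sides by the factor \<open>C\<close>. On the other sides the shift is harmless for large
  \<open>s\<close>, because the gap between \<gamma>' and \<gamma> gains a factor that grows
  exponentially in \<open>s\<close>.\<close>

lemma box_sides_absorb:
  assumes \<sigma>: "\<And>j. j < m \<Longrightarrow> \<sigma> j > 0" and \<rho>: "\<And>i. i < n \<Longrightarrow> \<rho> i > 0" and C: "C \<ge> 1"
    and less: "\<gamma>' < \<gamma>"
  obtains h S where "h \<ge> 0"
    "\<And>s i. s > S \<Longrightarrow> i < m + n \<Longrightarrow> C * box_sides m \<sigma> \<rho> s \<gamma> i \<le> box_sides m \<sigma> \<rho> (s + h) \<gamma>' i"
proof
  \<comment> \<open>A sum of nonnegative terms dominates each of them and so replaces a maximum; the
    same device gives \<open>S\<close>.\<close>
  define h where "h = (\<Sum>j<m. ln C / \<sigma> j)"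
  define S where "S = (\<Sum>i<n. \<bar>ln C + h * \<rho> i * \<gamma>'\<bar> / (\<rho> i * (\<gamma> - \<gamma>')))"
  have lnC: "ln C \<ge> 0" "C = exp (ln C)" using C by simp_all
  show "h \<ge> 0" unfolding h_def using lnC(1) \<sigma> by (intro sum_nonneg divide_nonneg_pos) auto
  fix s i assume s: "s > S" and i: "i < m + n"
  show "C * box_sides m \<sigma> \<rho> s \<gamma> i \<le> box_sides m \<sigma> \<rho> (s + h) \<gamma>' i"
  proof (cases "i < m")
    case True
    have "ln C / \<sigma> i \<le> h" unfolding h_def
      using True lnC(1) \<sigma> by (intro member_le_sum divide_nonneg_pos) auto
    then have "ln C \<le> h * \<sigma> i" using \<sigma>[OF True] by (simp add: field_simps)
    then have "exp (ln C) * exp (s * \<sigma> i) \<le> exp ((s + h) * \<sigma> i)"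
      unfolding exp_add[symmetric] by (simp add: algebra_simps)
    then show ?thesis using True lnC(2) by (simp add: box_sides_def)
  next
    case False
    define l where "l = i - m"
    have l: "l < n" using False i by (simp add: l_def)
    have pos: "\<rho> l * (\<gamma> - \<gamma>') > 0" using \<rho>[OF l] less by simp
    have "\<bar>ln C + h * \<rho> l * \<gamma>'\<bar> / (\<rho> l * (\<gamma> - \<gamma>')) \<le> S" unfolding S_def
      using l less \<rho> by (intro member_le_sum[where f = "\<lambda>i. \<bar>ln C + h * \<rho> i * \<gamma>'\<bar> / (\<rho> i * (\<gamma> - \<gamma>'))"])
        (auto intro!: divide_nonneg_pos)
    then have "\<bar>ln C + h * \<rho> l * \<gamma>'\<bar> / (\<rho> l * (\<gamma> - \<gamma>')) \<le> s" using s by simp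
    then have "\<bar>ln C + h * \<rho> l * \<gamma>'\<bar> \<le> s * (\<rho> l * (\<gamma> - \<gamma>'))" using pos by (simp add: pos_divide_le_eq)
    then have "ln C + h * \<rho> l * \<gamma>' \<le> s * (\<rho> l * (\<gamma> - \<gamma>'))" by linarith
    then have "exp (ln C) * exp (- (s * \<rho> l * \<gamma>)) \<le> exp (- ((s + h) * \<rho> l * \<gamma>'))"
      unfolding exp_add[symmetric] by (simp add: algebra_simps)
    then show ?thesis using False lnC(2) by (simp add: box_sides_def l_def)
  qed
qed

text \<open>The descent loses a constant factor, so an admissible \<gamma> in degree
  \<open>Suc k\<close> makes only each smaller \<gamma>' admissible in degree \<open>k\<close>; this
  suffices for the suprema.\<close>

lemma Omega_Suc_le:
  assumes \<Theta>: "\<Theta> \<in> carrier_mat n m" and \<sigma>: "\<And>j. j < m \<Longrightarrow> \<sigma> j > 0" and \<rho>: "\<And>i. i < n \<Longrightarrow> \<rho> i > 0"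
    and k: "k \<ge> 1"
  shows "Omega (Suc k) \<sigma> \<rho> \<Theta> \<le> Omega k \<sigma> \<rho> \<Theta>"
proof -
  have dims: "dim_col \<Theta> = m" "dim_row \<Theta> = n" using \<Theta> by auto
  let ?L = "theta_lattice \<Theta>"
  obtain C where C: "C \<ge> 1" and desc: "\<forall>L c Z. discrete_lattice (m + n) L \<longrightarrow> (\<forall>i<m + n. c i > 0) \<longrightarrow>
     Z \<in> exterior_lattice (m + n) (Suc k) L \<longrightarrow> Z \<noteq> 0 \<longrightarrow> Z \<in> compound_box (m + n) (Suc k) c \<longrightarrow>
     (\<exists>W\<in>exterior_lattice (m + n) k L. W \<noteq> 0 \<and> W \<in> exterior_power (m + n) k \<and>
        (\<forall>I\<in>index_sets (m + n) k. \<bar>W I\<bar> \<le> C * (\<Prod>i\<in>I. c i)))"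
    using compound_box_descent[of "m + n" k] by (elim exE conjE)
  have main: "\<gamma>' \<in> exponents k \<sigma> \<rho> \<Theta>" if \<gamma>: "\<gamma> \<in> exponents (Suc k) \<sigma> \<rho> \<Theta>" and less: "\<gamma>' < \<gamma>" for \<gamma> \<gamma>'
  proof -
    obtain h S0 where h: "h \<ge> 0" and absorb: "\<And>s i. s > S0 \<Longrightarrow> i < m + n \<Longrightarrow>
        C * box_sides m \<sigma> \<rho> s \<gamma> i \<le> box_sides m \<sigma> \<rho> (s + h) \<gamma>' i"
      using box_sides_absorb[of m \<sigma> n \<rho> C \<gamma>' \<gamma>] \<sigma> \<rho> C less by metis
    show ?thesis unfolding exponents_def dims
    proof (intro CollectI allI)
      fix S
      obtain s Z where s: "s > max S S0" and Z: "Z \<in> exterior_lattice (m + n) (Suc k) ?L" "Z \<noteq> 0"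
          "Z \<in> compound_box (m + n) (Suc k) (box_sides m \<sigma> \<rho> s \<gamma>)"
        using \<gamma> unfolding exponents_def dims by blast
      obtain W where W: "W \<in> exterior_lattice (m + n) k ?L" "W \<noteq> 0" "W \<in> exterior_power (m + n) k"
          "\<And>I. I \<in> index_sets (m + n) k \<Longrightarrow> \<bar>W I\<bar> \<le> C * (\<Prod>i\<in>I. box_sides m \<sigma> \<rho> s \<gamma> i)"
        using desc discrete_theta_lattice[OF \<Theta>] Z by (metis box_sides_pos)
      have "\<bar>W I\<bar> \<le> (\<Prod>i\<in>I. box_sides m \<sigma> \<rho> (s + h) \<gamma>' i)" if I: "I \<in> index_sets (m + n) k" for I
      proof -
        have I': "I \<subseteq> {..<m + n}" "card I = k" using I by (auto simp: index_sets_def)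
        have P0: "(\<Prod>i\<in>I. box_sides m \<sigma> \<rho> s \<gamma> i) > 0" by (rule prod_pos) simp
        have "\<bar>W I\<bar> \<le> C * (\<Prod>i\<in>I. box_sides m \<sigma> \<rho> s \<gamma> i)" by (rule W(4)[OF I])
        \<comment> \<open>Since \<open>k \<ge> 1\<close>, one factor \<open>C\<close> can be granted
          to each of the \<open>k\<close> sides.\<close>
        also have "\<dots> \<le> C ^ k * (\<Prod>i\<in>I. box_sides m \<sigma> \<rho> s \<gamma> i)"
          using power_increasing[OF k C] P0 by (intro mult_right_mono) auto
        also have "\<dots> = (\<Prod>i\<in>I. C * box_sides m \<sigma> \<rho> s \<gamma> i)" using I' by (simp add: prod.distrib)
        also have "\<dots> \<le> (\<Prod>i\<in>I. box_sides m \<sigma> \<rho> (s + h) \<gamma>' i)"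
        proof (rule prod_mono)
          fix i assume "i \<in> I"
          then show "0 \<le> C * box_sides m \<sigma> \<rho> s \<gamma> i \<and>
              C * box_sides m \<sigma> \<rho> s \<gamma> i \<le> box_sides m \<sigma> \<rho> (s + h) \<gamma>' i"
            using absorb[of s i] s I'(1) C by (auto simp: less_imp_le)
        qed
        finally show ?thesis .
      qed
      then have "W \<in> compound_box (m + n) k (box_sides m \<sigma> \<rho> (s + h) \<gamma>')"
        using W(3) by (auto simp: compound_box_def index_sets_def)
      moreover have "s + h > S" using s h by simp
      ultimately show "\<exists>s>S. \<exists>Z\<in>exterior_lattice (m + n) k ?L. Z \<noteq> 0 \<and>
          Z \<in> compound_box (m + n) k (box_sides m \<sigma> \<rho> s \<gamma>')"
        using W(1,2) by blast
    qed
  qed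
  show ?thesis
    unfolding Omega_eq_Sup[of "Suc k"]
  proof (rule Sup_least, elim imageE)
    fix x \<gamma> assume x: "x = ereal \<gamma>" "\<gamma> \<in> exponents (Suc k) \<sigma> \<rho> \<Theta>"
    show "x \<le> Omega k \<sigma> \<rho> \<Theta>"
      unfolding x(1)
    proof (rule dense_le)
      fix y assume "y < ereal \<gamma>"
      then show "y \<le> Omega k \<sigma> \<rho> \<Theta>"
        unfolding Omega_eq_Sup by (cases y) (auto intro!: Sup_upper main[OF x(2)])
    qed
  qed
qed

section \<open>Transference\<close>

text \<open>Here the normalisation of the weights enters. The value is 1 for \<gamma> = 1, and
  division by one side yields the bounds on coordinates of degree \<open>m + n - 1\<close>.\<close>

lemma prod_box_sides:
  assumes "(\<Sum>j<m. \<sigma> j) = 1" "(\<Sum>i<n. \<rho> i) = 1"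
  shows "(\<Prod>i<m + n. box_sides m \<sigma> \<rho> s \<gamma> i) = exp (s * (1 - \<gamma>))"
proof -
  let ?e = "\<lambda>i. if i < m then s * \<sigma> i else - (s * \<rho> (i - m) * \<gamma>)"
  have "(\<Prod>i<m + n. box_sides m \<sigma> \<rho> s \<gamma> i) = exp (\<Sum>i<m + n. ?e i)"
    unfolding exp_sum[OF finite_lessThan] by (rule prod.cong) (auto simp: box_sides_def)
  also have "(\<Sum>i<m + n. ?e i) = (\<Sum>i<m. s * \<sigma> i) + (\<Sum>i<n. - (s * \<gamma>) * \<rho> i)"
    unfolding sum_lessThan_add by (simp add: mult_ac)
  also have "\<dots> = s * (1 - \<gamma>)"
    unfolding sum_distrib_left[symmetric] assms by (simp add: algebra_simps)
  finally show ?thesis .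
qed

section \<open>The generating matrix of \<Lambda>(\<Theta>) and its minors\<close>

definition basis_coeffs :: "nat \<Rightarrow> nat \<Rightarrow> int" where
  "basis_coeffs l i = (if i = l then 1 else 0)"

text \<open>The block matrix that generates \<Lambda>(\<Theta>), built from its columns so that its
  minors appear as coordinates of wedges of lattice vectors.\<close>

definition theta_mat :: "real mat \<Rightarrow> real mat" where
  "theta_mat \<Theta> = (let d = dim_col \<Theta> + dim_row \<Theta> in
     mat d d (\<lambda>(a, l). theta_vec \<Theta> (basis_coeffs l) $ a))"

lemma theta_mat_carrier: "\<Theta> \<in> carrier_mat n m \<Longrightarrow> theta_mat \<Theta> \<in> carrier_mat (m + n) (m + n)"
  by (auto simp: theta_mat_def Let_def)

lemma theta_mat_index:
  assumes "\<Theta> \<in> carrier_mat n m" "l < m + n"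
  shows "j < m \<Longrightarrow> theta_mat \<Theta> $$ (j, l) = (if j = l then 1 else 0)"
    and "i < n \<Longrightarrow> theta_mat \<Theta> $$ (m + i, l) =
      (if l < m then - (\<Theta> $$ (i, l)) else if l = m + i then 1 else 0)"
proof -
  have "(\<Sum>j<m. \<Theta> $$ (i, j) * of_int (basis_coeffs l j)) = (\<Sum>j<m. if j = l then \<Theta> $$ (i, j) else 0)"
    by (intro sum.cong) (auto simp: basis_coeffs_def)
  then have *: "(\<Sum>j<m. \<Theta> $$ (i, j) * of_int (basis_coeffs l j)) = (if l < m then \<Theta> $$ (i, l) else 0)"
    by simp
  show "j < m \<Longrightarrow> theta_mat \<Theta> $$ (j, l) = (if j = l then 1 else 0)"
    using assms by (auto simp: theta_mat_def Let_def theta_vec_index(1)[OF assms(1)] basis_coeffs_def)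
  show "i < n \<Longrightarrow> theta_mat \<Theta> $$ (m + i, l) =
      (if l < m then - (\<Theta> $$ (i, l)) else if l = m + i then 1 else 0)"
  proof -
    assume i: "i < n"
    have "theta_mat \<Theta> $$ (m + i, l) = theta_vec \<Theta> (basis_coeffs l) $ (m + i)"
      using assms i by (auto simp: theta_mat_def Let_def)
    also have "\<dots> = of_int (basis_coeffs l (m + i)) - (if l < m then \<Theta> $$ (i, l) else 0)"
      unfolding theta_vec_index(2)[OF assms(1) i] * ..
    finally show ?thesis by (auto simp: basis_coeffs_def)
  qed
qed

lemma det_theta_mat:
  assumes \<Theta>: "\<Theta> \<in> carrier_mat n m"
  shows "det (theta_mat \<Theta>) = 1"
proof -
  have idx: "theta_mat \<Theta> $$ (a, l) = (if a = l then 1 else 0)" if "a \<le> l" "l < m + n" for a l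
  proof (cases "a < m")
    case True
    then show ?thesis using theta_mat_index(1)[OF \<Theta> that(2) True] by simp
  next
    case False
    then show ?thesis using theta_mat_index(2)[OF \<Theta> that(2), of "a - m"] that by auto
  qed
  have "det (theta_mat \<Theta>) = prod_list (diag_mat (theta_mat \<Theta>))"
    by (rule det_lower_triangular[OF _ theta_mat_carrier[OF \<Theta>]]) (use idx in auto)
  also have "\<dots> = (\<Prod>i = 0..<m + n. theta_mat \<Theta> $$ (i, i))"
    using theta_mat_carrier[OF \<Theta>] by (simp add: prod_list_diag_prod)
  also have "\<dots> = 1" by (rule prod.neutral) (use idx in auto)
  finally show ?thesis .
qed

lemma wedge_basis:
  assumes \<Theta>: "\<Theta> \<in> carrier_mat n m" and I: "I \<in> index_sets (m + n) k" and g: "\<And>l. l < k \<Longrightarrow> g l < m + n"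
  shows "wedge (m + n) (map (\<lambda>l. theta_vec \<Theta> (basis_coeffs (g l))) [0..<k]) I =
    det (mat k k (\<lambda>(a, l). theta_mat \<Theta> $$ (pick I a, g l)))"
proof -
  have pI: "pick I a < m + n" if "a < k" for a using pick_in_set_le[of a I] index_setsD[OF I] that by auto
  have dims: "dim_col \<Theta> = m" "dim_row \<Theta> = n" using \<Theta> by auto
  show ?thesis
    using I pI g by (subst wedge_eq_det)
      (auto intro!: arg_cong[of _ _ det] eq_matI simp: fvec_def theta_mat_def Let_def dims)
qed

lemma pick_lessThan: "a < d \<Longrightarrow> pick {..<d} a = a"
  using pick_reduce_set[of a d UNIV] by (simp add: pick_UNIV lessThan_def)

text \<open>This matches the minor on all rows but \<open>i\<close> with \<open>mat_delete\<close>,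
  and hence with a cofactor up to sign. Exactly the \<open>a\<close> values
  \<open>insert_index i x\<close> with \<open>x < a\<close> precede
  \<open>insert_index i a\<close>.\<close>

lemma pick_lessThan_remove:
  assumes "i < d" "a < d - 1"
  shows "pick ({..<d} - {i}) a = insert_index i a"
proof -
  let ?I = "{..<d} - {i}"
  have "insert_index i a \<in> ?I" using assms by (auto simp: insert_index_def)
  moreover have "{x \<in> ?I. x < insert_index i a} = insert_index i ` {..<a}"
  proof (intro equalityI subsetI)
    fix x assume x: "x \<in> {x \<in> ?I. x < insert_index i a}"
    show "x \<in> insert_index i ` {..<a}"
    proof (rule image_eqI)
      show "x = insert_index i (delete_index i x)"
        using x by (auto simp: insert_index_def delete_index_def)
      show "delete_index i x \<in> {..<a}" using x by (auto simp: insert_index_def delete_index_def split: if_splits)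
    qed
  qed (use assms in \<open>auto simp: insert_index_def split: if_splits\<close>)
  moreover have "card (insert_index i ` {..<a}) = a"
    by (subst card_image) (auto simp: inj_on_def insert_index_def split: if_splits)
  ultimately show ?thesis using pick_card_in_set[of "insert_index i a" ?I] by simp
qed

text \<open>The wedge of the whole lattice basis has the single coordinate 1, the determinant, and
  for \<gamma> = 1 the bound on that coordinate is 1 for every \<open>s\<close>. With monotonicity
  this gives the lower bound 1 in all degrees.\<close>

lemma Omega_top_ge_1:
  assumes \<Theta>: "\<Theta> \<in> carrier_mat n m" and \<sigma>: "(\<Sum>j<m. \<sigma> j) = 1" and \<rho>: "(\<Sum>i<n. \<rho> i) = 1"
  shows "Omega (m + n) \<sigma> \<rho> \<Theta> \<ge> 1"
proof -
  have dims: "dim_col \<Theta> = m" "dim_row \<Theta> = n" using \<Theta> by auto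
  define Z where "Z = wedge (m + n) (map (\<lambda>l. theta_vec \<Theta> (basis_coeffs l)) [0..<m + n])"
  have Z_in: "Z \<in> exterior_lattice (m + n) (m + n) (theta_lattice \<Theta>)"
    unfolding Z_def theta_lattice_eq by (rule wedge_in_exterior_lattice) auto
  have sets: "I \<in> index_sets (m + n) (m + n) \<longleftrightarrow> I = {..<m + n}" for I
    using card_subset_eq[of "{..<m + n}" I] by (auto simp: index_sets_def)
  have "Z {..<m + n} = det (mat (m + n) (m + n) (\<lambda>(a, l). theta_mat \<Theta> $$ (pick {..<m + n} a, l)))"
    unfolding Z_def by (rule wedge_basis[OF \<Theta>, where g = "\<lambda>l. l"]) (auto simp: sets)
  also have "mat (m + n) (m + n) (\<lambda>(a, l). theta_mat \<Theta> $$ (pick {..<m + n} a, l)) = theta_mat \<Theta>"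
    using theta_mat_carrier[OF \<Theta>] by (intro eq_matI) (auto simp: pick_lessThan)
  finally have Z1: "Z {..<m + n} = 1" using det_theta_mat[OF \<Theta>] by simp
  have "Z \<in> exterior_power (m + n) (m + n)"
    using wedge_outside[of _ "m + n" "map (\<lambda>l. theta_vec \<Theta> (basis_coeffs l)) [0..<m + n]"]
    by (auto simp: exterior_power_def Z_def index_sets_def)
  then have "Z \<in> compound_box (m + n) (m + n) (box_sides m \<sigma> \<rho> s 1)" for s
    using sets Z1 prod_box_sides[OF \<sigma> \<rho>, of s 1] by (auto simp: compound_box_def index_sets_def)
  moreover have "Z \<noteq> 0" using Z1 by auto
  ultimately have "1 \<in> exponents (m + n) \<sigma> \<rho> \<Theta>"
    unfolding exponents_def dims using Z_in gt_ex by blast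
  then show ?thesis unfolding Omega_eq_Sup by (auto intro!: Sup_upper2 simp: one_ereal_def)
qed

text \<open>
  The Hodge star identifies the \<open>(d - 1)\<close>-st exterior power of \<open>\<Lambda>(\<Theta>)\<close> with its dual lattice,
  which is \<open>\<Lambda>(\<^sup>t\<Theta>)\<close> up to signs and a permutation of the coordinates.
\<close>

lemma hodge_theta_lattice:
  fixes q :: "nat \<Rightarrow> int"
  assumes \<Theta>: "\<Theta> \<in> carrier_mat n m" and d: "d = m + n"
  defines "v \<equiv> theta_vec (transpose_mat \<Theta>) q"
  obtains Z where "Z \<in> exterior_lattice d (d - 1) (theta_lattice \<Theta>)"
    "Z \<in> exterior_power d (d - 1)"
    "\<And>j. j < m \<Longrightarrow> \<bar>Z ({..<d} - {j})\<bar> = \<bar>v $ (n + j)\<bar>"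
    "\<And>i. i < n \<Longrightarrow> \<bar>Z ({..<d} - {m + i})\<bar> = \<bar>v $ i\<bar>"
proof -
  define A where "A = theta_mat \<Theta>"
  have A: "A \<in> carrier_mat d d" using theta_mat_carrier[OF \<Theta>] by (simp add: A_def d)
  \<comment> \<open>Chosen so that the row vector \<open>w\<close> with \<open>w A = u\<close> has
    the entries of \<open>v\<close>: first its last \<open>m\<close> entries with opposite sign,
    then its first \<open>n\<close> entries.\<close>
  define u :: "nat \<Rightarrow> int" where "u l = (if l < m then - q (n + l) else q (l - m))" for l
  \<comment> \<open>All basis vectors except the one with index \<open>l\<close>.\<close>
  define zs where "zs l = map (\<lambda>c. theta_vec \<Theta> (basis_coeffs (insert_index l c))) [0..<d - 1]" for l
  define Z where "Z = (\<lambda>I. \<Sum>l<d. of_int (u l * (- 1) ^ l) * wedge d (zs l) I)"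
  have zs_in: "wedge d (zs l) \<in> exterior_lattice d (d - 1) (theta_lattice \<Theta>)" for l
    unfolding theta_lattice_eq by (rule wedge_in_exterior_lattice) (auto simp: zs_def)
  have closed: "0 \<in> exterior_lattice d (d - 1) (theta_lattice \<Theta>)"
    "\<And>x y. x \<in> exterior_lattice d (d - 1) (theta_lattice \<Theta>) \<Longrightarrow>
      y \<in> exterior_lattice d (d - 1) (theta_lattice \<Theta>) \<Longrightarrow> x - y \<in> exterior_lattice d (d - 1) (theta_lattice \<Theta>)"
    unfolding exterior_lattice_def by (auto intro: group_closure.diff)
  have 1: "Z \<in> exterior_lattice d (d - 1) (theta_lattice \<Theta>)"
    unfolding Z_def
    by (intro subgroup_sum[OF closed(1)] subgroup_int_mult[OF closed(1)] closed(2) zs_in) auto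
  have 2: "Z \<in> exterior_power d (d - 1)"
    using wedge_outside[of _ d "zs _"] by (auto simp: exterior_power_def Z_def zs_def index_sets_def)
  \<comment> \<open>Up to sign, \<open>w i\<close> is the coordinate of \<open>Z\<close> that omits
    \<open>i\<close>: the powers of -1 in \<open>Z\<close> turn minors into cofactors.\<close>
  define w where "w i = (\<Sum>l<d. of_int (u l) * cofactor A i l)" for i
  have Zw: "\<bar>Z ({..<d} - {i})\<bar> = \<bar>w i\<bar>" if i: "i < d" for i
  proof -
    have I: "{..<d} - {i} \<in> index_sets (m + n) (d - 1)" using i by (auto simp: index_sets_def d)
    have "Z ({..<d} - {i}) = (\<Sum>l<d. of_int (u l * (- 1) ^ l) * det (mat_delete A i l))"
      unfolding Z_def
    proof (intro sum.cong refl arg_cong2[of _ _ _ _ "(*)"])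
      fix l assume l: "l \<in> {..<d}"
      have "wedge d (zs l) ({..<d} - {i}) =
          det (mat (d - 1) (d - 1) (\<lambda>(a, c). A $$ (pick ({..<d} - {i}) a, insert_index l c)))"
        unfolding zs_def A_def d
        by (rule wedge_basis[OF \<Theta> I[unfolded d]]) (auto simp: insert_index_def)
      also have "mat (d - 1) (d - 1) (\<lambda>(a, c). A $$ (pick ({..<d} - {i}) a, insert_index l c)) = mat_delete A i l"
        using A i l by (intro eq_matI) (auto simp: mat_delete_def pick_lessThan_remove insert_index_def)
      finally show "wedge d (zs l) ({..<d} - {i}) = det (mat_delete A i l)" .
    qed
    also have "\<dots> = (- 1) ^ i * w i"
      unfolding w_def sum_distrib_left
      by (intro sum.cong refl) (simp add: cofactor_def power_add mult_ac flip: power_mult_distrib)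
    finally show ?thesis by (simp add: abs_mult)
  qed
  \<comment> \<open>Since \<open>det A = 1\<close>, the adjugate is the inverse of \<open>A\<close>;
    pairing \<open>w\<close> with the lattice basis gives the integers \<open>u\<close>, so
    \<open>w\<close> lies in the dual lattice.\<close>
  have wA: "(\<Sum>i<d. w i * A $$ (i, c)) = of_int (u c)" if c: "c < d" for c
  proof -
    have "(\<Sum>i<d. w i * A $$ (i, c)) = (\<Sum>l<d. of_int (u l) * (\<Sum>i<d. cofactor A i l * A $$ (i, c)))"
      unfolding w_def sum_distrib_left sum_distrib_right by (subst sum.swap) (simp add: mult_ac)
    also have "\<dots> = (\<Sum>l<d. if l = c then of_int (u l) else 0)"
    proof (rule sum.cong[OF refl])
      fix l assume "l \<in> {..<d}"
      then have l: "l < d" by simp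
      have "(\<Sum>i<d. cofactor A i l * A $$ (i, c)) = (adj_mat A * A) $$ (l, c)"
        using A l c adj_mat(1)[OF A] by (auto simp: scalar_prod_def adj_mat_def atLeast0LessThan intro!: sum.cong)
      also have "\<dots> = (if l = c then 1 else 0)"
        unfolding adj_mat(3)[OF A] using l c det_theta_mat[OF \<Theta>] by (simp add: A_def)
      finally show "of_int (u l) * (\<Sum>i<d. cofactor A i l * A $$ (i, c)) = (if l = c then of_int (u l) else 0)"
        by simp
    qed
    also have "\<dots> = of_int (u c)" using c by simp
    finally show ?thesis .
  qed
  have split: "(\<Sum>i<d. w i * A $$ (i, c)) =
      (\<Sum>j<m. w j * A $$ (j, c)) + (\<Sum>i<n. w (m + i) * A $$ (m + i, c))" for c
    unfolding d by (rule sum_lessThan_add)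
  have idx1: "(\<Sum>j<m. w j * A $$ (j, c)) = (if c < m then w c else 0)" if c: "c < d" for c
  proof -
    have "(\<Sum>j<m. w j * A $$ (j, c)) = (\<Sum>j<m. if j = c then w j else 0)"
      using theta_mat_index(1)[OF \<Theta>, of c] c by (intro sum.cong) (auto simp: A_def d)
    then show ?thesis by simp
  qed
  have w_low: "w (m + i) = of_int (q i)" if i: "i < n" for i
  proof -
    have c: "m + i < d" using i by (simp add: d)
    have "(\<Sum>l<n. w (m + l) * A $$ (m + l, m + i)) = (\<Sum>l<n. if l = i then w (m + l) else 0)"
      using theta_mat_index(2)[OF \<Theta>, of "m + i"] c by (intro sum.cong) (auto simp: A_def d)
    then show ?thesis using wA[OF c] split[of "m + i"] idx1[OF c] i by (simp add: u_def)
  qed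
  have \<Theta>': "transpose_mat \<Theta> \<in> carrier_mat m n" using \<Theta> by simp
  have w_up: "w j = - v $ (n + j)" if j: "j < m" for j
  proof -
    have c: "j < d" using j by (simp add: d)
    have "(\<Sum>l<n. w (m + l) * A $$ (m + l, j)) = - (\<Sum>l<n. \<Theta> $$ (l, j) * of_int (q l))"
      unfolding sum_negf[symmetric] using theta_mat_index(2)[OF \<Theta>, of j] c j
      by (intro sum.cong) (auto simp: A_def d w_low)
    moreover have "v $ (n + j) = of_int (q (n + j)) - (\<Sum>l<n. \<Theta> $$ (l, j) * of_int (q l))"
      unfolding v_def theta_vec_index(2)[OF \<Theta>' j] using \<Theta> j by (auto intro!: sum.cong)
    ultimately show ?thesis using wA[OF c] split[of j] idx1[OF c] j by (simp add: u_def)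
  qed
  show ?thesis
  proof (rule that[OF 1 2])
    show "\<bar>Z ({..<d} - {j})\<bar> = \<bar>v $ (n + j)\<bar>" if "j < m" for j
      using Zw[of j] w_up[OF that] that by (simp add: d)
    show "\<bar>Z ({..<d} - {m + i})\<bar> = \<bar>v $ i\<bar>" if "i < n" for i
      using Zw[of "m + i"] w_low[OF that] theta_vec_index(1)[OF \<Theta>' that, of q] that by (simp add: d v_def)
  qed
qed

text \<open>As \<open>L\<close> is already closed under differences, the group generated in degree 1
  contains nothing beyond \<open>L\<close>, with coordinates indexed by singletons.\<close>

lemma exterior_lattice_1:
  assumes L: "discrete_lattice d L" and Z: "Z \<in> exterior_lattice d 1 L"
  shows "\<exists>x\<in>L. \<forall>i<d. Z {i} = x $ i"
  using Z unfolding exterior_lattice_def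
proof (induction rule: group_closure.induct)
  case (base Z)
  show ?case
  proof (cases "Z = 0")
    case True
    then show ?thesis using L by (intro bexI[of _ "0\<^sub>v d"]) (auto simp: discrete_lattice_def)
  next
    case False
    then obtain zs where zs: "length zs = 1" "set zs \<subseteq> L" "Z = wedge d zs" using base by auto
    then obtain x where x: "zs = [x]" "x \<in> L" by (auto simp: length_Suc_conv)
    have "Z {i} = x $ i" if "i < d" for i
    proof -
      have "{i} \<in> index_sets d (length zs)" using that x by (simp add: index_sets_def)
      moreover have "pick {i} 0 = i" using pick_in_set_le[of 0 "{i}"] by simp
      ultimately show ?thesis
        using that wedge_eq_det[of "{i}" d zs]
        by (simp add: zs(3) x det_single fvec_def del: pick.simps)
    qed
    then show ?thesis using x by blast
  qed
next
  case (diff Z W)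
  then obtain x y where "x \<in> L" "\<forall>i<d. Z {i} = x $ i" "y \<in> L" "\<forall>i<d. W {i} = y $ i" by blast
  then show ?case using L
    by (intro bexI[of _ "x - y"]) (auto simp: discrete_lattice_def)
qed

text \<open>The Hodge star sends a short vector for the transpose, at parameter \<open>t\<close>, to
  a point of degree \<open>m + n - 1\<close>. Its coordinate omitting \<open>l\<close> may be as
  large as the product of all sides divided by the \<open>l\<close>-th. Each \<open>l\<close> thus
  gives a linear inequality, and as \<gamma> \<ge> 1 it is hardest for the smallest weight of its
  kind.\<close>

lemma transference_exponents:
  assumes m: "m \<ge> 1" and \<Theta>: "\<Theta> \<in> carrier_mat n m"
    and \<sigma>: "\<And>j. j < m \<Longrightarrow> 1 \<le> a * \<sigma> j" "(\<Sum>j<m. \<sigma> j) = 1"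
    and \<rho>: "\<And>i. i < n \<Longrightarrow> 1 \<le> b * \<rho> i" "(\<Sum>i<n. \<rho> i) = 1"
    and a: "a \<ge> 1" and b: "b \<ge> 1"
    and \<delta>: "\<delta> \<in> exponents 1 \<rho> \<sigma> (transpose_mat \<Theta>)" "\<delta> \<ge> 1"
  shows "((a - 1) + b * \<delta>) / (a + (b - 1) * \<delta>) \<in> exponents (m + n - 1) \<sigma> \<rho> \<Theta>"
proof -
  define d where "d = m + n"
  define D where "D = a + (b - 1) * \<delta>"
  define \<gamma> where "\<gamma> = ((a - 1) + b * \<delta>) / D"
  \<comment> \<open>The ratio \<open>t / s\<close>. Equality for weights \<open>1 / a\<close> and
    \<open>1 / b\<close> gives the two equations of \<open>\<kappa>_eq\<close>, whose solution is
    this pair of \<gamma> and \<kappa>.\<close>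
  define \<kappa> where "\<kappa> = (a + b - 1) / D"
  have D: "D > 0" using a b \<delta>(2) by (auto simp: D_def intro!: add_pos_nonneg)
  have \<kappa>: "\<kappa> > 0" using D a b by (simp add: \<kappa>_def)
  have \<gamma>1: "\<gamma> \<ge> 1" using D \<delta>(2) by (simp add: \<gamma>_def D_def field_simps)
  have \<kappa>_eq: "\<kappa> = \<gamma> - b * (\<gamma> - 1)" "\<kappa> * \<delta> = 1 + a * (\<gamma> - 1)"
    using D by (simp_all add: \<gamma>_def \<kappa>_def field_simps) (simp_all add: D_def algebra_simps)
  have dims: "dim_col \<Theta> = m" "dim_row \<Theta> = n" using \<Theta> by auto
  have \<Theta>': "transpose_mat \<Theta> \<in> carrier_mat m n" using \<Theta> by simp
  have "\<gamma> \<in> exponents (d - 1) \<sigma> \<rho> \<Theta>"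
    unfolding exponents_def dims d_def[symmetric]
  proof (intro CollectI allI)
    fix S
    obtain t Y where t: "t > max (S * \<kappa>) 0"
      and Y: "Y \<in> exterior_lattice (n + m) 1 (theta_lattice (transpose_mat \<Theta>))" "Y \<noteq> 0"
        "Y \<in> compound_box (n + m) 1 (box_sides n \<rho> \<sigma> t \<delta>)"
      using \<delta>(1) unfolding exponents_def index_transpose_mat dims by blast
    define s where "s = t / \<kappa>"
    have s: "s > S" "s > 0" "t = s * \<kappa>" using t \<kappa> by (auto simp: s_def field_simps)
    obtain q where q: "\<And>i. i < n + m \<Longrightarrow> Y {i} = theta_vec (transpose_mat \<Theta>) q $ i"
      using exterior_lattice_1[OF discrete_theta_lattice[OF \<Theta>'] Y(1)] unfolding theta_lattice_eq by blast
    define v where "v = theta_vec (transpose_mat \<Theta>) q"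
    have v_le: "\<bar>v $ i\<bar> \<le> box_sides n \<rho> \<sigma> t \<delta> i" if "i < n + m" for i
      using Y(3) q[OF that] that by (auto simp: compound_box_def v_def dest!: spec[of _ "{i}"])
    have "\<exists>i<n + m. v $ i \<noteq> 0"
    proof (rule ccontr)
      assume no: "\<not> ?thesis"
      have "Y I = 0" for I
      proof (cases "I \<subseteq> {..<n + m} \<and> card I = 1")
        case True
        then obtain i where "I = {i}" "i < n + m" by (auto simp: card_1_singleton_iff)
        then show ?thesis using q no by (simp add: v_def)
      next
        case False
        then show ?thesis using Y(3) by (simp add: compound_box_def exterior_power_def)
      qed
      then show False using Y(2) by (auto simp: fun_eq_iff)
    qed
    then obtain i0 where i0: "i0 < n + m" "v $ i0 \<noteq> 0" by blast
    obtain Z where Z: "Z \<in> exterior_lattice d (d - 1) (theta_lattice \<Theta>)" "Z \<in> exterior_power d (d - 1)"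
      "\<And>j. j < m \<Longrightarrow> \<bar>Z ({..<d} - {j})\<bar> = \<bar>v $ (n + j)\<bar>"
      "\<And>i. i < n \<Longrightarrow> \<bar>Z ({..<d} - {m + i})\<bar> = \<bar>v $ i\<bar>"
      using hodge_theta_lattice[OF \<Theta> d_def, of q] unfolding v_def by blast
    have Z0: "Z \<noteq> 0"
    proof (cases "i0 < n")
      case True
      then show ?thesis using Z(4)[OF True] i0(2) by auto
    next
      case False
      then have "i0 - n < m" "n + (i0 - n) = i0" using i0(1) by auto
      then show ?thesis using Z(3)[of "i0 - n"] i0(2) by auto
    qed
    have "\<bar>Z I\<bar> \<le> (\<Prod>i\<in>I. box_sides m \<sigma> \<rho> s \<gamma> i)" if I: "I \<subseteq> {..<d}" "card I = d - 1" for I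
    proof -
      \<comment> \<open>A coordinate of degree \<open>d - 1\<close> is determined by its omitted
        index \<open>l\<close>, which is either a row or a column index of \<Theta>.\<close>
      have "card ({..<d} - I) = 1" using I m card_Diff_subset[of I "{..<d}"] finite_subset[OF I(1)]
        by (simp add: d_def)
      then obtain l where "{..<d} - I = {l}" by (auto simp: card_1_singleton_iff)
      then have l: "l < d" "I = {..<d} - {l}" using I(1) by auto
      have "(\<Prod>i<d. box_sides m \<sigma> \<rho> s \<gamma> i) = box_sides m \<sigma> \<rho> s \<gamma> l * (\<Prod>i\<in>I. box_sides m \<sigma> \<rho> s \<gamma> i)"
        unfolding l(2) using l(1) by (intro prod.remove) auto
      then have P: "(\<Prod>i\<in>I. box_sides m \<sigma> \<rho> s \<gamma> i) = exp (s * (1 - \<gamma>)) / box_sides m \<sigma> \<rho> s \<gamma> l"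
        using prod_box_sides[OF \<sigma>(2) \<rho>(2), of s \<gamma>] box_sides_pos[of m \<sigma> \<rho> s \<gamma> l]
        by (simp add: d_def nonzero_eq_divide_eq less_imp_neq[symmetric] mult.commute)
      show ?thesis
      proof (cases "l < m")
        case True
        have "(\<gamma> - 1) * 1 \<le> (\<gamma> - 1) * (a * \<sigma> l)" using \<gamma>1 \<sigma>(1)[OF True] by (intro mult_left_mono) auto
        then have "- (\<kappa> * \<delta> * \<sigma> l) \<le> 1 - \<gamma> - \<sigma> l" unfolding \<kappa>_eq(2) by (simp add: algebra_simps)
        then have "s * (- (\<kappa> * \<delta> * \<sigma> l)) \<le> s * (1 - \<gamma> - \<sigma> l)" using s(2) by (intro mult_left_mono) auto
        then have "exp (- (t * \<sigma> l * \<delta>)) \<le> exp (s * (1 - \<gamma>)) / exp (s * \<sigma> l)"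
          unfolding exp_diff[symmetric] by (simp add: s(3) algebra_simps)
        then show ?thesis
          unfolding P using v_le[of "n + l"] True Z(3)[OF True] by (simp add: l(2) box_sides_def)
      next
        case False
        define i where "i = l - m"
        have i: "i < n" "l = m + i" using False l(1) by (auto simp: i_def d_def)
        have "(\<gamma> - 1) * 1 \<le> (\<gamma> - 1) * (b * \<rho> i)" using \<gamma>1 \<rho>(1)[OF i(1)] by (intro mult_left_mono) auto
        then have "\<kappa> * \<rho> i \<le> 1 - \<gamma> + \<rho> i * \<gamma>" unfolding \<kappa>_eq(1) by (simp add: algebra_simps)
        then have "s * (\<kappa> * \<rho> i) \<le> s * (1 - \<gamma> + \<rho> i * \<gamma>)" using s(2) by (intro mult_left_mono) auto
        then have "exp (t * \<rho> i) \<le> exp (s * (1 - \<gamma>)) / exp (- (s * \<rho> i * \<gamma>))"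
          unfolding exp_diff[symmetric] by (simp add: s(3) algebra_simps)
        then show ?thesis
          unfolding P using v_le[of i] i(1) Z(4)[OF i(1)] by (simp add: l(2) i(2) box_sides_def)
      qed
    qed
    then have "Z \<in> compound_box d (d - 1) (box_sides m \<sigma> \<rho> s \<gamma>)"
      using Z(2) by (simp add: compound_box_def)
    then show "\<exists>s>S. \<exists>Z\<in>exterior_lattice d (d - 1) (theta_lattice \<Theta>).
        Z \<noteq> 0 \<and> Z \<in> compound_box d (d - 1) (box_sides m \<sigma> \<rho> s \<gamma>)"
      using s(1) Z(1) Z0 by blast
  qed
  then show ?thesis by (simp add: \<gamma>_def D_def d_def)
qed

text \<open>The bound is an increasing function of \<open>w\<close>; its inverse turns the claim into a linear inequality.\<close>

lemma transference_bound_Sup_le: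
  assumes a: "a \<ge> 1" and b: "b \<ge> 1" and W: "Sup (ereal ` T) \<ge> 1" and X: "X \<ge> 1"
    and le: "\<And>\<delta>. \<delta> \<in> T \<Longrightarrow> \<delta> \<ge> 1 \<Longrightarrow> ereal (((a - 1) + b * \<delta>) / (a + (b - 1) * \<delta>)) \<le> X"
  shows "transference_bound a b (Sup (ereal ` T)) \<le> X"
proof (cases X)
  case (real x)
  have x: "x \<ge> 1" using X real by (simp add: one_ereal_def)
  \<comment> \<open>For \<delta> \<ge> 1 the fraction is at most \<open>x\<close> exactly if
    \<open>\<delta> * D \<le> a * x - (a - 1)\<close>. This bounds \<delta> from above only if
    \<open>D > 0\<close>; otherwise it holds trivially, the right side being at least 1.\<close>
  define D where "D = b - (b - 1) * x"
  have ax: "a * x - (a - 1) \<ge> 1" using mult_left_mono[OF x, of a] a by simp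
  have bounded: "Sup (ereal ` T) \<le> ereal ((a * x - (a - 1)) / D)" if D: "D > 0"
  proof (rule Sup_least, elim imageE)
    fix y \<delta> assume y: "y = ereal \<delta>" and \<delta>: "\<delta> \<in> T"
    have "\<delta> * D \<le> a * x - (a - 1)"
    proof (cases "\<delta> \<ge> 1")
      case True
      have "a + (b - 1) * \<delta> > 0" using a b True by (auto intro!: add_pos_nonneg)
      then have "(a - 1) + b * \<delta> \<le> x * (a + (b - 1) * \<delta>)"
        using le[OF \<delta> True] real by (simp add: pos_divide_le_eq)
      then show ?thesis by (simp add: D_def algebra_simps)
    next
      case False
      have "\<delta> * D \<le> 1 * D" using False D by (intro mult_right_mono) auto
      moreover have "0 \<le> (x - 1) * (a + b - 1)" using x a b by simp
      ultimately show ?thesis by (simp add: D_def algebra_simps)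
    qed
    then show "y \<le> ereal ((a * x - (a - 1)) / D)" using D by (simp add: y pos_le_divide_eq)
  qed
  show ?thesis
  proof (cases "Sup (ereal ` T)")
    case W': (real w)
    have w: "w \<ge> 1" using W W' by (simp add: one_ereal_def)
    have "w * D \<le> a * x - (a - 1)"
    proof (cases "D > 0")
      case True
      then show ?thesis using bounded W' by (simp add: pos_le_divide_eq)
    next
      case False
      then have "w * D \<le> 0" using w by (simp add: mult_nonneg_nonpos)
      then show ?thesis using ax by simp
    qed
    then have "(a - 1) + b * w \<le> x * (a + (b - 1) * w)" by (simp add: D_def algebra_simps)
    moreover have "a + (b - 1) * w > 0" using a b w by (auto intro!: add_pos_nonneg)
    ultimately show ?thesis by (simp add: transference_bound_def W' real pos_divide_le_eq)
  next
    case PInf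
    \<comment> \<open>A positive \<open>D\<close> would bound the supremum. Hence
      \<open>D \<le> 0\<close>, which excludes \<open>b = 1\<close> and says that \<open>x\<close>
      is at least the limit value of the fraction.\<close>
    then have "D \<le> 0" using bounded by fastforce
    then have le0: "b \<le> (b - 1) * x" by (simp add: D_def)
    then have "b \<noteq> 1" by auto
    then have "b > 1" using b by simp
    then have "b / (b - 1) \<le> x" using le0 by (simp add: pos_divide_le_eq mult.commute)
    then show ?thesis using \<open>b \<noteq> 1\<close> by (simp add: transference_bound_def PInf real)
  next
    case MInf
    then show ?thesis using W by simp
  qed
qed (use X in auto)

lemma Omega_antimono:
  assumes \<Theta>: "\<Theta> \<in> carrier_mat n m" and \<sigma>: "\<And>j. j < m \<Longrightarrow> \<sigma> j > 0" and \<rho>: "\<And>i. i < n \<Longrightarrow> \<rho> i > 0"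
    and k: "1 \<le> k" "k \<le> l"
  shows "Omega l \<sigma> \<rho> \<Theta> \<le> Omega k \<sigma> \<rho> \<Theta>"
  using k(2)
proof (induction l rule: dec_induct)
  case (step l)
  have "Omega (Suc l) \<sigma> \<rho> \<Theta> \<le> Omega l \<sigma> \<rho> \<Theta>"
    by (rule Omega_Suc_le[OF \<Theta>]) (use \<sigma> \<rho> k step in auto)
  then show ?case using step.IH by simp
qed simp

section \<open>Assembly of the chain and of the transference inequality\<close>

theorem theorem4:
  fixes m n d :: nat and \<Theta> :: "real mat" and \<sigma> \<rho> :: "nat \<Rightarrow> real"
  assumes "m \<ge> 1" and "n \<ge> 1" and "d = m + n"
    and "\<Theta> \<in> carrier_mat n m"
    and "\<And>i j. i \<le> j \<Longrightarrow> j < m \<Longrightarrow> \<sigma> j \<le> \<sigma> i"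
    and "\<And>j. j < m \<Longrightarrow> \<sigma> j > 0"
    and "(\<Sum>j<m. \<sigma> j) = 1"
    and "\<And>i j. i \<le> j \<Longrightarrow> j < n \<Longrightarrow> \<rho> j \<le> \<rho> i"
    and "\<And>i. i < n \<Longrightarrow> \<rho> i > 0"
    and "(\<Sum>i<n. \<rho> i) = 1"
  shows "(\<forall>k. 1 \<le> k \<and> k + 1 \<le> d - 1 \<longrightarrow> Omega k \<sigma> \<rho> \<Theta> \<ge> Omega (k + 1) \<sigma> \<rho> \<Theta>) \<and>
    Omega (d - 1) \<sigma> \<rho> \<Theta> \<ge>
      transference_bound (inverse (\<sigma> (m - 1))) (inverse (\<rho> (n - 1)))
        (Omega 1 \<rho> \<sigma> (transpose_mat \<Theta>))"
proof -
  \<comment> \<open>By monotonicity the last weight is the smallest, and it is at most the total 1.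
    This provides the hypotheses on \<open>a\<close> and \<open>b\<close>, for both families of
    weights.\<close>
  have weight: "1 \<le> inverse (\<tau> (l - 1)) \<and> (\<forall>j<l. 1 \<le> inverse (\<tau> (l - 1)) * \<tau> j)"
    if l: "l \<ge> 1" and mono: "\<And>i j. i \<le> j \<Longrightarrow> j < l \<Longrightarrow> \<tau> j \<le> \<tau> i"
      and pos: "\<And>j. j < l \<Longrightarrow> \<tau> j > 0" and sum: "(\<Sum>j<l. \<tau> j) = 1"
    for l and \<tau> :: "nat \<Rightarrow> real"
  proof -
    have p: "\<tau> (l - 1) > 0" using l pos by simp
    have "\<tau> (l - 1) \<le> (\<Sum>j<l. \<tau> j)" using l pos by (intro member_le_sum) (auto simp: less_imp_le)
    then have "1 \<le> inverse (\<tau> (l - 1))" using p sum by (simp add: one_le_inverse_iff)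
    moreover have "1 \<le> inverse (\<tau> (l - 1)) * \<tau> j" if "j < l" for j
      using mono[of j "l - 1"] that p by (simp add: field_simps)
    ultimately show ?thesis by blast
  qed
  note w\<sigma> = weight[OF assms(1,5,6,7)] and w\<rho> = weight[OF assms(2,8,9,10)]
  have \<Theta>': "transpose_mat \<Theta> \<in> carrier_mat m n" using assms(4) by simp
  have "1 \<le> Omega (n + m) \<rho> \<sigma> (transpose_mat \<Theta>)"
    by (rule Omega_top_ge_1[OF \<Theta>' assms(10,7)])
  also have "\<dots> \<le> Omega 1 \<rho> \<sigma> (transpose_mat \<Theta>)"
    by (rule Omega_antimono[OF \<Theta>']) (use assms in auto)
  finally have W: "1 \<le> Omega 1 \<rho> \<sigma> (transpose_mat \<Theta>)" .
  \<comment> \<open>The chain is extended to degree \<open>d\<close> only to obtain the lower bound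
    1 in degree \<open>d - 1\<close>.\<close>
  have "1 \<le> Omega (m + n) \<sigma> \<rho> \<Theta>" by (rule Omega_top_ge_1[OF assms(4,7,10)])
  also have "\<dots> \<le> Omega (d - 1) \<sigma> \<rho> \<Theta>"
    by (rule Omega_antimono[OF assms(4)]) (use assms in auto)
  finally have X: "1 \<le> Omega (d - 1) \<sigma> \<rho> \<Theta>" .
  have "transference_bound (inverse (\<sigma> (m - 1))) (inverse (\<rho> (n - 1)))
      (Omega 1 \<rho> \<sigma> (transpose_mat \<Theta>)) \<le> Omega (d - 1) \<sigma> \<rho> \<Theta>"
    unfolding Omega_eq_Sup[of 1]
  proof (rule transference_bound_Sup_le)
    show "1 \<le> Sup (ereal ` exponents 1 \<rho> \<sigma> (transpose_mat \<Theta>))" using W by (simp add: Omega_eq_Sup)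
    fix \<delta> assume "\<delta> \<in> exponents 1 \<rho> \<sigma> (transpose_mat \<Theta>)" "\<delta> \<ge> 1"
    then have "((inverse (\<sigma> (m - 1)) - 1) + inverse (\<rho> (n - 1)) * \<delta>) /
        (inverse (\<sigma> (m - 1)) + (inverse (\<rho> (n - 1)) - 1) * \<delta>) \<in> exponents (m + n - 1) \<sigma> \<rho> \<Theta>"
      using transference_exponents[OF assms(1,4) _ assms(7) _ assms(10)] w\<sigma> w\<rho> by blast
    then show "ereal (((inverse (\<sigma> (m - 1)) - 1) + inverse (\<rho> (n - 1)) * \<delta>) /
        (inverse (\<sigma> (m - 1)) + (inverse (\<rho> (n - 1)) - 1) * \<delta>)) \<le> Omega (d - 1) \<sigma> \<rho> \<Theta>"
      unfolding Omega_eq_Sup assms(3) by (intro Sup_upper imageI)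
  qed (use w\<sigma> w\<rho> X in auto)
  moreover have "Omega (k + 1) \<sigma> \<rho> \<Theta> \<le> Omega k \<sigma> \<rho> \<Theta>" if "1 \<le> k" for k
    by (rule Omega_antimono[OF assms(4)]) (use assms that in auto)
  ultimately show ?thesis by blast
qed

end
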